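(* Let $k$ be an algebraically closed field of characteristic zero. For $a\in k$ with $a^3\ne0,-1$, let $X_a\subset\mathbb{P}^5$ be the $9$-nodal cubic threefold given by $$x_1x_2x_3-x_4x_5x_6=a(x_1+x_2+x_3)+x_4+x_5+x_6=0.$$ Then the $C_3$-action on $X_a$ via the permutation of coordinates $$(x_1,x_2,x_3,x_4,x_5,x_6)\mapsto(x_3,x_1,x_2,x_6,x_4,x_5)$$ is linearizable for all $a$ with $a^3\ne0,-1$. When $a=1$, the $C_6$-action on $X_1$ via $$(x_1,x_2,x_3,x_4,x_5,x_6)\mapsto(x_6,x_4,x_5,x_3,x_1,x_2)$$ is linearizable.
   Context: The action of a finite group $G$ on a threefold $X$ is linearizable if $X$ is $G$-equivariantly birational to $\mathbb{P}^3=\mathbb{P}(V)$ with action induced by a linear representation of $G$ on a $4$-dimensional vector space $V$. *)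

theory Defs
  imports
    "HOL-Analysis.Analysis"
    "HOL-Computational_Algebra.Polynomial"
    "HOL-Library.Poly_Mapping"
    "HOL-Algebra.Elementary_Groups"
    "HOL-Algebra.Group_Action"
begin

text \<open>
  Classical projective varieties over a field. The monoid algebra \<open>('n \<Rightarrow>\<^sub>0 nat) \<Rightarrow>\<^sub>0 'k\<close> of
  \<^theory>\<open>HOL-Library.Poly_Mapping\<close> is the polynomial ring over \<open>'k\<close> in variables indexed by
  the finite type \<open>'n\<close>.
\<close>

type_synonym ('n, 'k) mpoly = "('n \<Rightarrow>\<^sub>0 nat) \<Rightarrow>\<^sub>0 'k"

definition mpoly_eval :: "('n::finite, 'k::comm_ring_1) mpoly \<Rightarrow> 'k ^ 'n \<Rightarrow> 'k" where
  "mpoly_eval f x = (\<Sum>m\<in>Poly_Mapping.keys f.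
     Poly_Mapping.lookup f m * (\<Prod>i\<in>UNIV. (x $ i) ^ Poly_Mapping.lookup m i))"

definition homogeneous :: "nat \<Rightarrow> ('n::finite, 'k::zero) mpoly \<Rightarrow> bool" where
  "homogeneous d f \<longleftrightarrow>
     (\<forall>m\<in>Poly_Mapping.keys f. (\<Sum>i\<in>UNIV. Poly_Mapping.lookup m i) = d)"

text \<open>\<open>\<bbbP>(V)\<close> for \<open>V = 'k ^ 'n\<close>: its points are the lines through the origin, as subsets of \<open>V\<close>.\<close>

definition projective_space :: "('k::field ^ 'n) set set" where
  "projective_space = {vec.span {v} | v. v \<noteq> 0}"

text \<open>
  The Zariski topology, generated by the standard open sets \<open>f \<noteq> 0\<close> with \<open>f\<close> a form.
  The form \<open>1\<close> shows that the underlying space is all of \<^const>\<open>projective_space\<close>.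
\<close>

definition zariski :: "('k::field ^ 'n::finite) set topology" where
  "zariski = topology_generated_by
     {{p \<in> projective_space. \<exists>v\<in>p. mpoly_eval f v \<noteq> 0} | f. \<exists>d. homogeneous d f}"

text \<open>
  Regular maps between (locally closed) subsets of projective spaces: locally given by a tuple of
  forms of the same degree without common zero.
\<close>

definition regular_map ::
    "('k::field ^ 'n::finite) set set \<Rightarrow> ('k ^ 'm::finite) set set
       \<Rightarrow> (('k ^ 'n) set \<Rightarrow> ('k ^ 'm) set) \<Rightarrow> bool" where
  "regular_map U W \<phi> \<longleftrightarrow> \<phi> ` U \<subseteq> W \<and>
     (\<forall>p\<in>U. \<exists>N d F. openin (subtopology zariski U) N \<and> p \<in> N \<and>
        (\<forall>i. homogeneous d (F i)) \<and>
        (\<forall>q\<in>N. \<forall>v\<in>q - {0}. (\<chi> i. mpoly_eval (F i) v) \<noteq> 0 \<and>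
           \<phi> q = vec.span {\<chi> i. mpoly_eval (F i) v}))"

definition dense_open ::
    "('k::field ^ 'n::finite) set set \<Rightarrow> ('k ^ 'n) set set \<Rightarrow> bool" where
  "dense_open X U \<longleftrightarrow> openin (subtopology zariski X) U \<and> X \<subseteq> zariski closure_of U"

definition regular_action ::
    "('g, 'b) monoid_scheme \<Rightarrow> ('k::field ^ 'n::finite) set set
       \<Rightarrow> ('g \<Rightarrow> ('k ^ 'n) set \<Rightarrow> ('k ^ 'n) set) \<Rightarrow> bool" where
  "regular_action G X \<alpha> \<longleftrightarrow>
     group_action G X \<alpha> \<and> (\<forall>g\<in>carrier G. regular_map X X (\<alpha> g))"

text \<open>
  A birational map is an isomorphism \<open>\<phi>\<close> between dense open subsets \<open>U\<close> and \<open>W\<close>, with inverse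
  \<open>\<psi>\<close>. It is equivariant if \<open>\<phi> \<circ> g = g \<circ> \<phi>\<close> as rational maps, i.e. wherever both sides are
  defined by the chosen representative. Irreducibility of \<open>X\<close> is not assumed: since \<open>U\<close> and \<open>W\<close>
  are dense, it follows from that of \<open>Y\<close>.
\<close>

definition equivariantly_birational ::
    "('g, 'b) monoid_scheme
       \<Rightarrow> ('k::field ^ 'n::finite) set set \<Rightarrow> ('g \<Rightarrow> ('k ^ 'n) set \<Rightarrow> ('k ^ 'n) set)
       \<Rightarrow> ('k ^ 'm::finite) set set \<Rightarrow> ('g \<Rightarrow> ('k ^ 'm) set \<Rightarrow> ('k ^ 'm) set) \<Rightarrow> bool" where
  "equivariantly_birational G X \<alpha> Y \<beta> \<longleftrightarrow>
     (\<exists>U W \<phi> \<psi>. dense_open X U \<and> dense_open Y W \<and>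
        regular_map U W \<phi> \<and> regular_map W U \<psi> \<and>
        (\<forall>p\<in>U. \<psi> (\<phi> p) = p) \<and> (\<forall>q\<in>W. \<phi> (\<psi> q) = q) \<and>
        (\<forall>g\<in>carrier G. \<forall>p\<in>U. \<alpha> g p \<in> U \<longrightarrow> \<phi> (\<alpha> g p) = \<beta> g (\<phi> p)))"

definition general_linear_group :: "('k::field ^ 'n ^ 'n) monoid" where
  "general_linear_group = \<lparr>carrier = {A. invertible A}, monoid.mult = (**), one = mat 1\<rparr>"

text \<open>
  Linearizability of an action of a finite group on a threefold \<open>X\<close>; the \<open>4\<close>-dimensional
  representation is written in coordinates, as a homomorphism to \<open>GL\<^sub>4\<close>.
\<close>

definition linearizable ::
    "('g, 'b) monoid_scheme \<Rightarrow> ('k::field ^ 'n::finite) set set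
       \<Rightarrow> ('g \<Rightarrow> ('k ^ 'n) set \<Rightarrow> ('k ^ 'n) set) \<Rightarrow> bool" where
  "linearizable G X \<alpha> \<longleftrightarrow> finite (carrier G) \<and> regular_action G X \<alpha> \<and>
     (\<exists>\<rho> \<in> hom G (general_linear_group :: ('k ^ 4 ^ 4) monoid).
        equivariantly_birational G X \<alpha> projective_space (\<lambda>g p. (*v) (\<rho> g) ` p))"

text \<open>
  The action on \<open>X\<close> of the cyclic group \<^term>\<open>integer_mod_group n\<close> whose generator acts by the
  linear map \<open>s\<close>. The maps are restricted to \<open>X\<close> because \<^const>\<open>BijGroup\<close> has extensional elements.
\<close>

definition cyclic_action ::
    "('k::field ^ 'n) set set \<Rightarrow> ('k ^ 'n \<Rightarrow> 'k ^ 'n) \<Rightarrow> int \<Rightarrow> ('k ^ 'n) set \<Rightarrow> ('k ^ 'n) set" where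
  "cyclic_action X s i = restrict (((`) s) ^^ nat i) X"

text \<open>In the index type \<open>6\<close> the numeral \<open>6\<close> equals \<open>0\<close>, so \<open>1, \<dots>, 6\<close> are its six elements.\<close>

definition cubic_threefold :: "'k::field \<Rightarrow> ('k ^ 6) set set" where
  "cubic_threefold a = {p \<in> projective_space. \<forall>x\<in>p.
     x $ 1 * x $ 2 * x $ 3 - x $ 4 * x $ 5 * x $ 6 = 0 \<and>
     a * (x $ 1 + x $ 2 + x $ 3) + x $ 4 + x $ 5 + x $ 6 = 0}"

definition perm3 :: "'k::field ^ 6 \<Rightarrow> 'k ^ 6" where
  "perm3 x = vector [x $ 3, x $ 1, x $ 2, x $ 6, x $ 4, x $ 5]"

definition perm6 :: "'k::field ^ 6 \<Rightarrow> 'k ^ 6" where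
  "perm6 x = vector [x $ 6, x $ 4, x $ 5, x $ 3, x $ 1, x $ 2]"

end

theory Submission
  imports Defs
begin

text \<open>
  Put \<open>d\<^sub>i = x\<^bsub>i+3\<^esub> - x\<^sub>i\<close>, \<open>r\<^sub>i = (x\<^bsub>i+3\<^esub> + x\<^sub>i) / d\<^sub>i\<close> and \<open>z\<^sub>i = a x\<^sub>i + x\<^bsub>i+3\<^esub>\<close> for
  \<open>i = 1, 2, 3\<close>. The cubic equation becomes \<open>r\<^sub>1 r\<^sub>2 + r\<^sub>2 r\<^sub>3 + r\<^sub>3 r\<^sub>1 = -1\<close> and the linear one becomes
  \<open>z\<^sub>1 + z\<^sub>2 + z\<^sub>3 = 0\<close>, so \<open>X\<close> is birational to a quadric surface times a line. With the resolvents
  \<open>R\<^sub>j = r\<^sub>1 + \<omega>\<^sup>j r\<^sub>2 + \<omega>\<^bsup>2j\<^esup> r\<^sub>3\<close> for a primitive cube root of unity \<open>\<omega>\<close>, the quadric reads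
  \<open>R\<^sub>1 R\<^sub>2 = R\<^sub>0\<^sup>2 + 3\<close>; hence \<open>(R\<^sub>0, R\<^sub>1)\<close> are birational coordinates on it, and
  \<open>u = (z\<^sub>1 + \<omega> z\<^sub>2 + \<omega>\<^sup>2 z\<^sub>3) / (z\<^sub>1 + \<omega>\<^sup>2 z\<^sub>2 + \<omega> z\<^sub>3)\<close> is one on the line. The \<open>C\<^sub>3\<close>-action permutes the \<open>r\<^sub>i\<close>
  and the \<open>z\<^sub>i\<close> cyclically, and for \<open>a = 1\<close> the generator of \<open>C\<^sub>6\<close> does so as well, up to the sign
  \<open>r \<mapsto> -r\<close>. Thus \<open>R\<^sub>0\<close>, \<open>R\<^sub>1\<close> and \<open>u\<close> are semi-invariant and \<open>[1 : R\<^sub>0 : R\<^sub>1 : u]\<close> is an equivariant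
  birational map to \<open>\<bbbP>\<^sup>3\<close> with a diagonal action.

  The domain of this map is dense because every point of \<open>X\<close> lies on a rational curve in \<open>X\<close> whose
  general point belongs to it, or to a set already known to lie in its closure.
\<close>

subsection \<open>Forms and the Zariski topology\<close>

text \<open>Forms are treated as functions rather than as polynomials, so that the degree of an
  explicit expression follows by closure rules.\<close>

definition form :: "nat \<Rightarrow> ('k::field ^ 'n::finite \<Rightarrow> 'k) \<Rightarrow> bool" where
  "form d f \<longleftrightarrow> (\<exists>F. homogeneous d F \<and> mpoly_eval F = f)"

definition locus :: "('k::field ^ 'n \<Rightarrow> 'k) \<Rightarrow> ('k ^ 'n) set set" where
  "locus f = {p \<in> projective_space. \<exists>v\<in>p. f v \<noteq> 0}"

section \<open>Evaluation of polynomials and arithmetic of forms\<close>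

lemma mpoly_eval_add: "mpoly_eval (f + g) x = mpoly_eval f x + mpoly_eval g x"
  unfolding mpoly_eval_def by (rule setsum_keys_plus_distrib) (auto simp: distrib_right)

lemma mpoly_eval_single:
  "mpoly_eval (Poly_Mapping.single m c) x = c * (\<Prod>i\<in>UNIV. (x $ i) ^ Poly_Mapping.lookup m i)"
  by (cases "c = 0") (auto simp: mpoly_eval_def)

lemma mpoly_eval_sum: "mpoly_eval (sum F A) x = (\<Sum>a\<in>A. mpoly_eval (F a) x)"
proof (induction A rule: infinite_finite_induct)
  case (insert a A)
  then show ?case by (simp add: mpoly_eval_add)
qed (auto simp: mpoly_eval_def)

text \<open>Both sides are biadditive, so expanding \<open>f\<close> and \<open>g\<close> into
  monomials reduces the claim to two monomials, where exponents add.\<close>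

lemma mpoly_eval_mult:
  fixes f g :: "('n::finite, 'k::comm_ring_1) mpoly"
  shows "mpoly_eval (f * g) x = mpoly_eval f x * mpoly_eval g x"
proof -
  let ?s = "\<lambda>(f :: ('n, 'k) mpoly) m. Poly_Mapping.single m (Poly_Mapping.lookup f m)"
  have *: "f = (\<Sum>m\<in>Poly_Mapping.keys f. ?s f m)" for f :: "('n, 'k) mpoly"
    by (rule poly_mapping_eqI)
      (auto simp: lookup_sum lookup_single when_def in_keys_iff)
  have "mpoly_eval (?s f m * ?s g n) x = mpoly_eval (?s f m) x * mpoly_eval (?s g n) x" for m n
    by (simp add: mult_single mpoly_eval_single lookup_add power_add prod.distrib)
  then have "mpoly_eval ((\<Sum>m\<in>Poly_Mapping.keys f. ?s f m) * (\<Sum>n\<in>Poly_Mapping.keys g. ?s g n)) x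
     = mpoly_eval (\<Sum>m\<in>Poly_Mapping.keys f. ?s f m) x * mpoly_eval (\<Sum>n\<in>Poly_Mapping.keys g. ?s g n) x"
    by (simp only: sum_product mpoly_eval_sum)
  then show ?thesis by (simp only: *[symmetric])
qed

lemma form_const: "form 0 (\<lambda>_. c)"
  unfolding form_def homogeneous_def
  by (intro exI[of _ "Poly_Mapping.single 0 c"]) (auto simp: mpoly_eval_single fun_eq_iff)

lemma form_zero: "form d (\<lambda>_. 0)"
  unfolding form_def homogeneous_def
  by (intro exI[of _ 0]) (auto simp: mpoly_eval_def)

lemma form_coord:
  fixes i :: "'n::finite"
  shows "form 1 (\<lambda>x :: 'k::field ^ 'n. x $ i)"
  unfolding form_def homogeneous_def
proof (intro exI[of _ "Poly_Mapping.single (Poly_Mapping.single i 1) 1"] conjI ext)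
  show "mpoly_eval (Poly_Mapping.single (Poly_Mapping.single i 1) 1) x = x $ i" for x :: "'k ^ 'n"
  proof -
    have "(\<Prod>j\<in>UNIV. (x $ j) ^ Poly_Mapping.lookup (Poly_Mapping.single i 1) j)
        = (\<Prod>j\<in>UNIV. if j = i then x $ j else 1)"
      by (rule prod.cong) (auto simp: lookup_single when_def)
    then show ?thesis by (simp add: mpoly_eval_single)
  qed
  show "\<forall>m\<in>Poly_Mapping.keys (Poly_Mapping.single (Poly_Mapping.single i (1::nat)) (1::'k)).
          (\<Sum>i\<in>UNIV. Poly_Mapping.lookup m i) = 1"
    by (simp add: lookup_single when_def)
qed

lemma form_add:
  assumes "form d f" "form d g"
  shows "form d (\<lambda>x. f x + g x)"
proof -
  obtain F G where "homogeneous d F" "mpoly_eval F = f" "homogeneous d G" "mpoly_eval G = g"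
    using assms unfolding form_def by blast
  then show ?thesis
    unfolding form_def homogeneous_def using keys_add[of F G]
    by (intro exI[of _ "F + G"]) (auto simp: mpoly_eval_add)
qed

lemma form_mult:
  assumes "form d f" "form e g"
  shows "form (d + e) (\<lambda>x. f x * g x)"
proof -
  obtain F G where FG: "homogeneous d F" "mpoly_eval F = f" "homogeneous e G" "mpoly_eval G = g"
    using assms unfolding form_def by blast
  have "homogeneous (d + e) (F * G)"
    unfolding homogeneous_def
  proof
    fix m assume "m \<in> Poly_Mapping.keys (F * G)"
    then obtain a b where "m = a + b" "a \<in> Poly_Mapping.keys F" "b \<in> Poly_Mapping.keys G"
      using keys_mult[of F G] by blast
    with FG show "(\<Sum>i\<in>UNIV. Poly_Mapping.lookup m i) = d + e"
      by (simp add: homogeneous_def lookup_add sum.distrib)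
  qed
  with FG show ?thesis
    unfolding form_def by (intro exI[of _ "F * G"]) (auto simp: mpoly_eval_mult)
qed

lemma form_cmult: "form d f \<Longrightarrow> form d (\<lambda>x. c * f x)"
  using form_mult[OF form_const, of d f c] by simp

lemma form_diff: "form d f \<Longrightarrow> form d g \<Longrightarrow> form d (\<lambda>x. f x - g x)"
  using form_add[of d f "\<lambda>x. (-1) * g x"] form_cmult[of d g "-1"] by simp

lemma form_power: "form d f \<Longrightarrow> form (d * n) (\<lambda>x. f x ^ n)"
  by (induction n) (auto intro: form_const dest: form_mult)

lemma form_scale:
  assumes "form d f"
  shows "f (c *s v) = c ^ d * f v"
proof -
  obtain F where F: "homogeneous d F" "mpoly_eval F = f"
    using assms unfolding form_def by blast
  have "mpoly_eval F (c *s v) = (\<Sum>m\<in>Poly_Mapping.keys F. c ^ d *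
      (Poly_Mapping.lookup F m * (\<Prod>i\<in>UNIV. (v $ i) ^ Poly_Mapping.lookup m i)))"
    unfolding mpoly_eval_def
  proof (rule sum.cong)
    fix m assume "m \<in> Poly_Mapping.keys F"
    then have "(\<Sum>i\<in>UNIV. Poly_Mapping.lookup m i) = d"
      using F unfolding homogeneous_def by blast
    then have "(\<Prod>i\<in>UNIV. c ^ Poly_Mapping.lookup m i) = c ^ d"
      by (simp add: power_sum[symmetric])
    then show "Poly_Mapping.lookup F m * (\<Prod>i\<in>UNIV. ((c *s v) $ i) ^ Poly_Mapping.lookup m i)
      = c ^ d * (Poly_Mapping.lookup F m * (\<Prod>i\<in>UNIV. (v $ i) ^ Poly_Mapping.lookup m i))"
      by (simp add: power_mult_distrib prod.distrib)
  qed simp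
  also have "\<dots> = c ^ d * mpoly_eval F v"
    by (simp only: sum_distrib_left mpoly_eval_def)
  finally show ?thesis using F by simp
qed

text \<open>This reduces non-vanishing on a polynomial curve to the finiteness of the zero set of a
  univariate polynomial.\<close>

lemma form_along_curve:
  assumes "form d f" and "\<And>i. \<exists>P. \<forall>s. \<gamma> s $ i = poly P s"
  shows "\<exists>P. \<forall>s. f (\<gamma> s) = poly P s"
proof -
  obtain F where F: "mpoly_eval F = f"
    using assms unfolding form_def by blast
  obtain P where P: "\<And>i s. \<gamma> s $ i = poly (P i) s"
    using assms(2) by metis
  have "f (\<gamma> s) = poly (\<Sum>m\<in>Poly_Mapping.keys F. Polynomial.smult (Poly_Mapping.lookup F m)
     (\<Prod>i\<in>UNIV. P i ^ Poly_Mapping.lookup m i)) s" for s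
    by (simp add: F[symmetric] mpoly_eval_def poly_sum poly_prod P)
  then show ?thesis by blast
qed

section \<open>Points of projective space as lines\<close>

lemma span_line: "vec.span {v :: 'k::field ^ 'n} = range (\<lambda>c. c *s v)"
  by (rule vec.span_singleton)

lemma span_line_scale:
  fixes v :: "'k::field ^ 'n"
  assumes "c \<noteq> 0" shows "vec.span {c *s v} = vec.span {v}"
proof -
  have "b *s v \<in> range (\<lambda>b. b *s (c *s v))" for b
    using assms by (intro image_eqI[of _ _ "b / c"]) auto
  moreover have "b *s (c *s v) \<in> range (\<lambda>b. b *s v)" for b
    by (intro image_eqI[of _ _ "b * c"]) auto
  ultimately show ?thesis unfolding span_line by blast
qed

lemma line_eq_span:
  assumes "q \<in> projective_space" "v \<in> q" "v \<noteq> 0"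
  shows "q = vec.span {v}"
proof -
  obtain u where "q = vec.span {u}" using assms by (auto simp: projective_space_def)
  moreover obtain c where "v = c *s u" using assms calculation by (auto simp: span_line)
  moreover have "c \<noteq> 0" using assms calculation by auto
  ultimately show ?thesis by (simp add: span_line_scale)
qed

lemma span_in_projective_space: "v \<noteq> 0 \<Longrightarrow> vec.span {v} \<in> projective_space"
  by (auto simp: projective_space_def)

lemma span_in_locus:
  assumes "form d f" "v \<noteq> 0"
  shows "vec.span {v} \<in> locus f \<longleftrightarrow> f v \<noteq> 0"
proof
  assume "vec.span {v} \<in> locus f"
  then show "f v \<noteq> 0"
    using form_scale[OF assms(1)] by (auto simp: locus_def span_line)
next
  assume "f v \<noteq> 0"
  then show "vec.span {v} \<in> locus f"
    using assms(2) by (auto simp: locus_def span_in_projective_space intro: vec.span_base)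
qed

section \<open>Basic open sets and closures\<close>

lemma topspace_zariski: "topspace (zariski :: ('k::field ^ 'n::finite) set topology) = projective_space"
proof -
  have "form 0 (\<lambda>_ :: 'k ^ 'n. 1)" by (rule form_const)
  then have "\<exists>F :: ('n, 'k) mpoly. homogeneous 0 F \<and> (\<forall>v. mpoly_eval F v = 1)"
    by (auto simp: form_def fun_eq_iff)
  then obtain F :: "('n, 'k) mpoly" where "homogeneous 0 F" "\<forall>v. mpoly_eval F v = 1"
    by blast
  moreover have "\<exists>v. v \<in> p" if "p \<in> projective_space" for p :: "('k ^ 'n) set"
    using that by (auto simp: projective_space_def intro: vec.span_base)
  ultimately have "projective_space \<in> {{p \<in> projective_space. \<exists>v\<in>p. mpoly_eval f v \<noteq> 0} |
      f :: ('n, 'k) mpoly. \<exists>d. homogeneous d f}"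
    by (intro CollectI exI[of _ F]) auto
  then show ?thesis
    unfolding zariski_def topology_generated_by_topspace by blast
qed

lemma openin_locus:
  assumes "form d f"
  shows "openin zariski (locus f)"
  unfolding zariski_def
proof (rule topology_generated_by_Basis)
  obtain F where "homogeneous d F" "mpoly_eval F = f"
    using assms unfolding form_def by blast
  then show "locus f \<in> {{p \<in> projective_space. \<exists>v\<in>p. mpoly_eval f v \<noteq> 0} | f. \<exists>d. homogeneous d f}"
    unfolding locus_def by blast
qed

text \<open>The generating sets form a basis and not only a subbasis, because the product of two
  forms is a form. The proof is by induction on the generation of open sets.\<close>

lemma zariski_nbhd:
  fixes v :: "'k::field ^ 'n::finite"
  assumes "openin zariski N" "vec.span {v} \<in> N" "v \<noteq> 0"
  shows "\<exists>d f. form d f \<and> f v \<noteq> 0 \<and> locus f \<subseteq> N"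
proof -
  have "generate_topology_on
     {{p \<in> projective_space. \<exists>v\<in>p. mpoly_eval f v \<noteq> 0} | f. \<exists>d. homogeneous d f} N"
    using assms(1) unfolding zariski_def by (rule openin_topology_generated_by)
  then show ?thesis using assms(2)
  proof induction
    case (Int a b)
    then obtain d f e g where *: "form d f" "f v \<noteq> 0" "locus f \<subseteq> a" "form e g" "g v \<noteq> 0" "locus g \<subseteq> b"
      by blast
    have "locus (\<lambda>x. f x * g x) \<subseteq> locus f \<inter> locus g"
      by (auto simp: locus_def)
    then show ?case
      using * by (intro exI[of _ "d + e"] exI[of _ "\<lambda>x. f x * g x"]) (auto intro: form_mult)
  next
    case (UN K)
    then show ?case by blast
  next
    case (Basis s)
    then obtain F d where F: "homogeneous d F" "s = locus (mpoly_eval F)"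
      by (auto simp: locus_def)
    have "form d (mpoly_eval F)" using F by (auto simp: form_def)
    then show ?case
      using F Basis span_in_locus[of d "mpoly_eval F" v] assms(3) by auto
  qed auto
qed

text \<open>A neighbourhood of the starting point contains some \<open>locus f\<close>. Along the
  curve \<open>f\<close> and \<open>g\<close> become nonzero polynomials in the parameter, and since
  the field is infinite some parameter avoids the zeros of both.\<close>

lemma closure_along_curve:
  fixes \<gamma> :: "'k::field_char_0 \<Rightarrow> 'k ^ 'n::finite"
  assumes \<gamma>: "\<And>i. \<exists>P. \<forall>s. \<gamma> s $ i = poly P s"
    and X: "\<And>s. \<gamma> s \<noteq> 0 \<Longrightarrow> vec.span {\<gamma> s} \<in> X"
    and g: "form e g" "g (\<gamma> t) \<noteq> 0" and nz: "\<gamma> 0 \<noteq> 0"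
  shows "vec.span {\<gamma> 0} \<in> zariski closure_of (X \<inter> locus g)"
  unfolding in_closure_of
proof (intro conjI allI impI)
  show "vec.span {\<gamma> 0} \<in> topspace zariski"
    using nz by (simp add: topspace_zariski span_in_projective_space)
  fix N assume N: "vec.span {\<gamma> 0} \<in> N \<and> openin zariski N"
  then obtain d f where f: "form d f" "f (\<gamma> 0) \<noteq> 0" "locus f \<subseteq> N"
    using zariski_nbhd nz by blast
  obtain Pf where Pf: "\<And>s. f (\<gamma> s) = poly Pf s" using form_along_curve[OF f(1) \<gamma>] by blast
  obtain Pg where Pg: "\<And>s. g (\<gamma> s) = poly Pg s" using form_along_curve[OF g(1) \<gamma>] by blast
  \<comment> \<open>A coordinate that is nonzero at the start is carried along to ensure that
    \<open>\<gamma> s\<close> is a nonzero vector and spans a point.\<close>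
  obtain i where i: "\<gamma> 0 $ i \<noteq> 0" using nz by (auto simp: vec_eq_iff)
  obtain Pi where Pi: "\<And>s. \<gamma> s $ i = poly Pi s" using \<gamma> by blast
  have "Pf \<noteq> 0" "Pg \<noteq> 0" "Pi \<noteq> 0"
    using f g i Pf Pg Pi by force+
  then have "finite {s. poly (Pf * Pg * Pi) s = 0}"
    by (intro poly_roots_finite) auto
  then obtain s where "poly (Pf * Pg * Pi) s \<noteq> 0"
    using infinite_UNIV_char_0[where 'a='k] by (metis (mono_tags, lifting) UNIV_eq_I mem_Collect_eq)
  then have s: "f (\<gamma> s) \<noteq> 0" "g (\<gamma> s) \<noteq> 0" "\<gamma> s \<noteq> 0"
    using Pf Pg Pi[of s] by auto
  then have "vec.span {\<gamma> s} \<in> X \<inter> locus g" "vec.span {\<gamma> s} \<in> N"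
    using X span_in_locus f g by blast+
  then show "\<exists>y. y \<in> X \<inter> locus g \<and> y \<in> N" by blast
qed

subsection \<open>A criterion for linearizability\<close>

definition form_map :: "nat \<Rightarrow> ('k::field ^ 'n::finite \<Rightarrow> 'k ^ 'm) \<Rightarrow> bool" where
  "form_map d F \<longleftrightarrow> (\<forall>i. form d (\<lambda>v. F v $ i))"

lemma form_map_scale: "form_map d F \<Longrightarrow> F (c *s v) = c ^ d *s F v"
  unfolding form_map_def vec_eq_iff by (metis form_scale vector_smult_component)

text \<open>A form map of degree \<open>d\<close> sends a line only to multiples of
  \<open>F v\<close> by \<open>d\<close>-th powers. Taking the span gives the induced map on points
  without a choice of representative.\<close>

lemma span_image_line:
  assumes "form_map d F"
  shows "vec.span (F ` vec.span {v}) = vec.span {F v}"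
proof
  show "vec.span (F ` vec.span {v}) \<subseteq> vec.span {F v}"
  proof (rule vec.span_minimal)
    show "F ` vec.span {v} \<subseteq> vec.span {F v}"
      using form_map_scale[OF assms] by (auto simp: span_line)
  qed simp
  show "vec.span {F v} \<subseteq> vec.span (F ` vec.span {v})"
    by (rule vec.span_mono) (auto intro: vec.span_base)
qed

lemma image_line:
  assumes "form_map 1 F"
  shows "F ` vec.span {v} = vec.span {F v}"
  using form_map_scale[OF assms] by (auto simp: span_line image_image)

text \<open>Substituting linear forms into a monomial gives a product of as many linear forms as its
  degree; the general case is a sum over monomials.\<close>

lemma form_map_comp_linear:
  assumes "form_map d F" "form_map 1 s"
  shows "form_map d (\<lambda>v. F (s v))"
proof -
  have "form d (\<lambda>v. f (s v))" if f: "form d f" for f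
  proof -
    obtain H where H: "homogeneous d H" "mpoly_eval H = f"
      using f unfolding form_def by blast
    have mono: "form (\<Sum>i\<in>I. m i) (\<lambda>v. \<Prod>i\<in>I. (s v $ i) ^ m i)" if "finite I" for I and m :: "_ \<Rightarrow> nat"
      using that
    proof induction
      case empty
      then show ?case by (simp add: form_const)
    next
      case (insert i I)
      have "form (1 * m i) (\<lambda>v. (s v $ i) ^ m i)"
        using assms(2) by (intro form_power) (simp add: form_map_def)
      then show ?case using insert form_mult by fastforce
    qed
    have "form d (\<lambda>v. \<Sum>m\<in>K. Poly_Mapping.lookup H m * (\<Prod>i\<in>UNIV. (s v $ i) ^ Poly_Mapping.lookup m i))"
      if "finite K" "K \<subseteq> Poly_Mapping.keys H" for K
      using that
    proof induction
      case empty
      show ?case by (simp add: form_zero)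
    next
      case (insert m K)
      have "form (\<Sum>i\<in>UNIV. Poly_Mapping.lookup m i) (\<lambda>v. \<Prod>i\<in>UNIV. (s v $ i) ^ Poly_Mapping.lookup m i)"
        by (rule mono) simp
      moreover have "(\<Sum>i\<in>UNIV. Poly_Mapping.lookup m i) = d"
        using H insert unfolding homogeneous_def by blast
      ultimately show ?case using insert by (simp add: form_add form_cmult)
    qed
    from this[OF finite_keys subset_refl] show ?thesis
      using H by (auto simp: mpoly_eval_def fun_eq_iff simp flip: H(2))
  qed
  with assms(1) show ?thesis unfolding form_map_def by blast
qed

lemma form_map_id: "form_map 1 (\<lambda>v. v)"
  unfolding form_map_def by (blast intro: form_coord)

lemma form_map_funpow:
  fixes s :: "'k::field ^ 'n::finite \<Rightarrow> 'k ^ 'n"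
  assumes "form_map 1 s" shows "form_map 1 (s ^^ k)"
proof (induction k)
  case 0
  then show ?case using form_map_id by (simp add: id_def)
next
  case (Suc k)
  then show ?case using form_map_comp_linear[OF Suc assms] by (simp only: funpow_Suc_right comp_def)
qed

lemma funpow_image:
  fixes s :: "'a \<Rightarrow> 'a"
  shows "(((`) s) ^^ k) p = (s ^^ k) ` p"
  by (induction k) (auto simp: image_image)

text \<open>One global tuple of forms serves at every point, so the neighbourhood in the definition
  can be all of \<open>U\<close>.\<close>

lemma regular_mapI:
  assumes "U \<subseteq> projective_space" "form_map d F" "\<phi> ` U \<subseteq> W"
    and "\<And>v. v \<noteq> 0 \<Longrightarrow> vec.span {v} \<in> U \<Longrightarrow> F v \<noteq> 0 \<and> \<phi> (vec.span {v}) = vec.span {F v}"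
  shows "regular_map U W \<phi>"
  unfolding regular_map_def
proof (intro conjI ballI)
  have "\<exists>H. homogeneous d H \<and> mpoly_eval H = (\<lambda>v. F v $ i)" for i
    using assms(2) unfolding form_map_def form_def by blast
  then obtain H where H: "\<And>i. homogeneous d (H i)" "\<And>i. mpoly_eval (H i) = (\<lambda>v. F v $ i)"
    by metis
  have HF: "(\<chi> i. mpoly_eval (H i) v) = F v" for v by (simp add: H vec_eq_iff)
  have U: "openin (subtopology zariski U) U"
    using assms(1) by (simp add: openin_subtopology_refl topspace_zariski)
  have *: "F v \<noteq> 0 \<and> \<phi> q = vec.span {F v}" if "q \<in> U" "v \<in> q - {0}" for q v
    using that assms(1,4) line_eq_span[of q v] by blast
  show "\<exists>N d F. openin (subtopology zariski U) N \<and> p \<in> N \<and> (\<forall>i. homogeneous d (F i)) \<and>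
      (\<forall>q\<in>N. \<forall>v\<in>q - {0}. (\<chi> i. mpoly_eval (F i) v) \<noteq> 0 \<and>
         \<phi> q = vec.span {\<chi> i. mpoly_eval (F i) v})" if "p \<in> U" for p
    by (intro exI[of _ U] exI[of _ d] exI[of _ H] conjI) (use U that H * in \<open>auto simp: HF\<close>)
qed (rule assms)

lemma power_mod_period:
  assumes "(c::'a::monoid_mult) ^ n = 1"
  shows "c ^ (k mod n) = c ^ k"
proof -
  have "c ^ k = c ^ (n * (k div n) + k mod n)" by simp
  also have "\<dots> = c ^ (k mod n)" using assms by (simp only: power_add power_mult) simp
  finally show ?thesis by simp
qed

text \<open>Since the \<open>n\<close>-th iterate of \<open>s\<close> is the identity, iterates
  depend only on the exponent modulo \<open>n\<close>. This yields both the homomorphism law and the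
  inverses.\<close>

lemma cyclic_action_regular:
  fixes s :: "'k::field ^ 'n::finite \<Rightarrow> 'k ^ 'n"
  assumes "0 < n" and X: "X \<subseteq> projective_space"
    and s: "form_map 1 s" "\<And>v. (s ^^ n) v = v" "\<And>p. p \<in> X \<Longrightarrow> s ` p \<in> X"
  shows "regular_action (integer_mod_group n) X (cyclic_action X s)"
proof -
  have closed: "((`) s ^^ k) p \<in> X" if "p \<in> X" for k p
    using that s(3) by (induction k) auto
  have period: "((`) s ^^ (k mod n)) p = ((`) s ^^ k) p" for k and p :: "('k ^ 'n) set"
  proof -
    have "((`) s ^^ n) = id" using s(2) by (auto simp: funpow_image fun_eq_iff)
    then have "((`) s ^^ (n * (k div n))) = id" by (simp add: funpow_mult[symmetric])
    then have "((`) s ^^ (n * (k div n) + k mod n)) = ((`) s ^^ (k mod n))"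
      by (simp only: funpow_add) simp
    then show ?thesis by simp
  qed
  have bij: "cyclic_action X s i \<in> Bij X" for i
  proof -
    have cancel: "((`) s ^^ k) (((`) s ^^ l) p) = p" if "k + l = nat i * n" for k l and p :: "('k ^ 'n) set"
    proof -
      have "((`) s ^^ k) (((`) s ^^ l) p) = ((`) s ^^ (k + l)) p" by (simp add: funpow_add)
      also have "\<dots> = ((`) s ^^ ((k + l) mod n)) p" by (simp only: period)
      finally show ?thesis using that by simp
    qed
    \<comment> \<open>The exponents \<open>nat i\<close> and \<open>nat i * (n - 1)\<close> add up
      to a multiple of \<open>n\<close>, so these iterates are mutually inverse.\<close>
    have "nat i + nat i * (n - 1) = nat i * n" using \<open>0 < n\<close> by (cases n) auto
    then have "bij_betw ((`) s ^^ nat i) X X"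
      using closed
      by (intro bij_betw_byWitness[where f' = "(`) s ^^ (nat i * (n - 1))"] ballI cancel) auto
    moreover have "bij_betw (cyclic_action X s i) X X \<longleftrightarrow> bij_betw ((`) s ^^ nat i) X X"
      by (rule bij_betw_cong) (simp add: cyclic_action_def)
    ultimately have "bij_betw (cyclic_action X s i) X X" by (rule iffD2[rotated])
    then show ?thesis
      by (simp add: Bij_def cyclic_action_def)
  qed
  have "group_action (integer_mod_group n) X (cyclic_action X s)"
    unfolding group_action_def group_hom_def group_hom_axioms_def
  proof (intro conjI group_integer_mod_group group_BijGroup homI)
    fix i j assume ij: "i \<in> carrier (integer_mod_group n)" "j \<in> carrier (integer_mod_group n)"
    then have "nat ((i + j) mod int n) = (nat i + nat j) mod n"
      using \<open>0 < n\<close> by (simp add: carrier_integer_mod_group nat_mod_distrib nat_add_distrib)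
    then have "cyclic_action X s (i \<otimes>\<^bsub>integer_mod_group n\<^esub> j) p
        = compose X (cyclic_action X s i) (cyclic_action X s j) p" for p
      using closed[of p "nat j"] by (simp add: cyclic_action_def compose_def period) (simp add: funpow_add)
    then show "cyclic_action X s (i \<otimes>\<^bsub>integer_mod_group n\<^esub> j)
        = cyclic_action X s i \<otimes>\<^bsub>BijGroup X\<^esub> cyclic_action X s j"
      using bij by (simp add: BijGroup_def fun_eq_iff)
  qed (use bij in \<open>auto simp: BijGroup_def\<close>)
  moreover have "regular_map X X (cyclic_action X s i)" for i
  proof (rule regular_mapI[OF X form_map_funpow[OF s(1), of "nat i"]])
    show "cyclic_action X s i ` X \<subseteq> X" using closed by (auto simp: cyclic_action_def)
    fix v :: "'k ^ 'n" assume v: "v \<noteq> 0" "vec.span {v} \<in> X"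
    \<comment> \<open>Otherwise the point spanned by \<open>v\<close> would be sent to
      \<open>{0}\<close>, which is not a line, although \<open>X\<close> is closed under the
      action.\<close>
    have "(s ^^ nat i) v \<noteq> 0"
    proof
      assume "(s ^^ nat i) v = 0"
      then have "(s ^^ nat i) ` vec.span {v} = {0}"
        using image_line[OF form_map_funpow[OF s(1)]] by simp
      then have "{0} \<in> X" using closed[OF v(2), of "nat i"] by (simp add: funpow_image)
      then obtain w :: "'k ^ 'n" where "{0} = vec.span {w}" "w \<noteq> 0"
        using X unfolding projective_space_def by blast
      then show False using vec.span_base[of w "{w}"] by blast
    qed
    then show "(s ^^ nat i) v \<noteq> 0 \<and> cyclic_action X s i (vec.span {v}) = vec.span {(s ^^ nat i) v}"
      using v by (simp add: cyclic_action_def funpow_image image_line[OF form_map_funpow[OF s(1)]])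
  qed
  ultimately show ?thesis unfolding regular_action_def by blast
qed

section \<open>Diagonal representations and the criterion itself\<close>

definition diag :: "'k::field ^ 'n \<Rightarrow> 'k ^ 'n ^ 'n" where
  "diag c = (\<chi> i j. if i = j then c $ i else 0)"

lemma diag_mult_vec: "diag c *v v = (\<chi> i. c $ i * v $ i)"
proof -
  have "(\<Sum>j\<in>UNIV. (if i = j then c $ i else 0) * v $ j) = (\<Sum>j\<in>UNIV. if i = j then c $ i * v $ j else 0)" for i
    by (rule sum.cong) auto
  then show ?thesis by (simp add: diag_def matrix_vector_mult_def vec_eq_iff)
qed

lemma diag_mult_diag: "diag c ** diag d = diag (\<chi> i. c $ i * d $ i)"
proof -
  have "(\<Sum>j\<in>UNIV. (if i = j then c $ i else 0) * (if j = k then d $ j else 0))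
      = (\<Sum>j\<in>UNIV. if i = j then (if i = k then c $ i * d $ i else 0) else 0)" for i k
    by (rule sum.cong) auto
  then show ?thesis by (simp add: diag_def matrix_matrix_mult_def vec_eq_iff)
qed

lemma diag_one: "diag (\<chi> i. 1) = mat 1"
  by (simp add: diag_def mat_def vec_eq_iff)

text \<open>Each diagonal entry is a character of the cyclic group, because \<open>c $ i\<close> is
  an \<open>n\<close>-th root of unity.\<close>

lemma diag_character_hom:
  fixes c :: "'k::field ^ 'n::finite"
  assumes "0 < n" "\<And>i. c $ i ^ n = 1"
  shows "(\<lambda>g. diag (\<chi> i. c $ i ^ nat g)) \<in> hom (integer_mod_group n) general_linear_group"
proof (rule homI)
  fix g h
  have c: "c $ i \<noteq> 0" for i using assms(1) assms(2)[of i] by (auto simp: power_0_left)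
  have "diag (\<chi> i. c $ i ^ nat g) ** diag (\<chi> i. inverse (c $ i ^ nat g)) = mat 1"
       "diag (\<chi> i. inverse (c $ i ^ nat g)) ** diag (\<chi> i. c $ i ^ nat g) = mat 1"
    by (simp_all add: diag_mult_diag c diag_one)
  then show "diag (\<chi> i. c $ i ^ nat g) \<in> carrier general_linear_group"
    by (auto simp: general_linear_group_def invertible_def)
  assume gh: "g \<in> carrier (integer_mod_group n)" "h \<in> carrier (integer_mod_group n)"
  then have "nat ((g + h) mod int n) = (nat g + nat h) mod n"
    using \<open>0 < n\<close> by (simp add: carrier_integer_mod_group nat_mod_distrib nat_add_distrib)
  then show "diag (\<chi> i. c $ i ^ nat (g \<otimes>\<^bsub>integer_mod_group n\<^esub> h))
      = diag (\<chi> i. c $ i ^ nat g) \<otimes>\<^bsub>general_linear_group\<^esub> diag (\<chi> i. c $ i ^ nat h)"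
    by (simp add: general_linear_group_def diag_mult_diag power_mod_period[OF assms(2)] power_add)
qed

text \<open>Any point is joined by a line to the point of \<open>w\<close>, where \<open>h\<close>
  does not vanish.\<close>

lemma dense_open_projective_space:
  fixes h :: "'k::field_char_0 ^ 'n::finite \<Rightarrow> 'k"
  assumes "form e h" "h w \<noteq> 0"
  shows "dense_open projective_space (locus h)"
  unfolding dense_open_def
proof
  have "locus h \<subseteq> projective_space" by (auto simp: locus_def)
  then show "openin (subtopology zariski projective_space) (locus h)"
    using openin_locus[OF assms(1)] by (auto simp: openin_subtopology)
  show "projective_space \<subseteq> zariski closure_of (locus h)"
  proof
    fix p :: "('k ^ 'n) set" assume "p \<in> projective_space"
    then obtain v where v: "p = vec.span {v}" "v \<noteq> 0" by (auto simp: projective_space_def)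
    define \<gamma> where "\<gamma> = (\<lambda>s. v + s *s (w - v))"
    have "\<exists>P. \<forall>s. \<gamma> s $ i = poly P s" for i
      by (intro exI[of _ "[:v $ i, w $ i - v $ i:]"]) (simp add: \<gamma>_def right_diff_distrib)
    moreover have "\<gamma> 0 = v" "\<gamma> 1 = w" by (simp_all add: \<gamma>_def)
    ultimately have "vec.span {v} \<in> zariski closure_of (projective_space \<inter> locus h)"
      using closure_along_curve[of \<gamma> projective_space e h 1] assms v(2) span_in_projective_space by metis
    then show "p \<in> zariski closure_of (locus h)"
      using v(1) \<open>locus h \<subseteq> projective_space\<close> by (simp add: Int_absorb1)
  qed
qed

text \<open>This reduces linearizability to vector identities: \<open>F\<close> and \<open>H\<close>
  are inverse up to nonzero scalars on the loci of \<open>g\<close> and \<open>h\<close>, and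
  \<open>F\<close> turns \<open>s\<close> into a diagonal matrix up to a factor \<open>l\<close>
  that is invisible in projective space.\<close>

lemma linearizableI:
  fixes X :: "('k::field_char_0 ^ 'n::finite) set set"
    and s :: "'k ^ 'n \<Rightarrow> 'k ^ 'n" and F :: "'k ^ 'n \<Rightarrow> 'k ^ 4" and H c
  assumes n: "0 < n" and X: "X \<subseteq> projective_space"
    and s: "form_map 1 s" "\<And>v. (s ^^ n) v = v" "\<And>p. p \<in> X \<Longrightarrow> s ` p \<in> X"
    and c: "\<And>i. c $ i ^ n = 1"
    and F: "form_map d F" and H: "form_map d' H"
    and g: "form e g" and h: "form e' h" "h w \<noteq> 0"
    and dense: "X \<subseteq> zariski closure_of (X \<inter> locus g)"
    and FH: "\<And>v. v \<noteq> 0 \<Longrightarrow> vec.span {v} \<in> X \<Longrightarrow> g v \<noteq> 0 \<Longrightarrow>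
        F v \<noteq> 0 \<and> h (F v) \<noteq> 0 \<and> (\<exists>m. m \<noteq> 0 \<and> H (F v) = m *s v)"
    and HF: "\<And>y. y \<noteq> 0 \<Longrightarrow> h y \<noteq> 0 \<Longrightarrow>
        H y \<noteq> 0 \<and> vec.span {H y} \<in> X \<and> g (H y) \<noteq> 0 \<and> (\<exists>m. m \<noteq> 0 \<and> F (H y) = m *s y)"
    and equi: "l \<noteq> 0" "\<And>v. F (s v) = l *s (\<chi> i. c $ i * F v $ i)"
  shows "linearizable (integer_mod_group n) X (cyclic_action X s)"
proof -
  let ?F = "\<lambda>p. vec.span (F ` p)" and ?H = "\<lambda>q. vec.span (H ` q)"
  let ?\<rho> = "\<lambda>g. diag (\<chi> i. c $ i ^ nat g)"
  note imF = span_image_line[OF F] and imH = span_image_line[OF H]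
  have U: "\<exists>v. v \<noteq> 0 \<and> p = vec.span {v} \<and> g v \<noteq> 0" if "p \<in> X \<inter> locus g" for p
    using that X span_in_locus[OF g] by (auto simp: projective_space_def)
  have W: "\<exists>v. v \<noteq> 0 \<and> p = vec.span {v} \<and> h v \<noteq> 0" if "p \<in> locus h" for p
    using that span_in_locus[OF h(1)] by (auto simp: locus_def projective_space_def)
  have HF': "?H q \<in> X \<inter> locus g \<and> ?F (?H q) = q" if q: "q \<in> locus h" for q
  proof -
    obtain y where y: "y \<noteq> 0" "q = vec.span {y}" "h y \<noteq> 0" using W[OF q] by blast
    then show ?thesis using HF[OF y(1,3)] span_in_locus[OF g]
      by (auto simp: imF imH span_line_scale)
  qed
  have FH': "?F p \<in> locus h \<and> ?H (?F p) = p" if p: "p \<in> X \<inter> locus g" for p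
  proof -
    obtain v where v: "v \<noteq> 0" "p = vec.span {v}" "g v \<noteq> 0" using U[OF p] by blast
    then show ?thesis using FH[OF v(1) _ v(3)] p span_in_locus[OF h(1)]
      by (auto simp: imF imH span_line_scale)
  qed
  have "dense_open X (X \<inter> locus g)"
    unfolding dense_open_def using dense openin_locus[OF g] by (auto simp: openin_subtopology)
  moreover have "dense_open projective_space (locus h)"
    by (rule dense_open_projective_space[OF h])
  moreover have "regular_map (X \<inter> locus g) (locus h) ?F"
  proof (rule regular_mapI[OF _ F])
    fix v assume "v \<noteq> 0" "vec.span {v} \<in> X \<inter> locus g"
    then show "F v \<noteq> 0 \<and> ?F (vec.span {v}) = vec.span {F v}"
      using FH[of v] span_in_locus[OF g] imF by blast
  qed (use X FH' in auto)
  moreover have "regular_map (locus h) (X \<inter> locus g) ?H"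
  proof (rule regular_mapI[OF _ H])
    fix v assume "v \<noteq> 0" "vec.span {v} \<in> locus h"
    then show "H v \<noteq> 0 \<and> ?H (vec.span {v}) = vec.span {H v}"
      using HF[of v] span_in_locus[OF h(1)] imH by blast
  qed (use HF' in \<open>auto simp: locus_def\<close>)
  moreover have "?F (cyclic_action X s k p) = (*v) (?\<rho> k) ` ?F p" if p: "p \<in> X" for k p
  proof -
    obtain v where v: "p = vec.span {v}" using p X by (auto simp: projective_space_def)
    \<comment> \<open>Iterating the semi-equivariance raises both the diagonal entries and the
      common factor to the \<open>j\<close>-th power.\<close>
    have pow: "F ((s ^^ j) v) = l ^ j *s (\<chi> i. c $ i ^ j * F v $ i)" for j
      by (induction j) (simp_all add: equi(2) vec_eq_iff mult_ac)
    have "?F (cyclic_action X s k p) = vec.span {\<chi> i. c $ i ^ nat k * F v $ i}"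
      using p equi(1) unfolding cyclic_action_def v
      by (simp add: funpow_image image_line[OF form_map_funpow[OF s(1)]] imF pow span_line_scale)
    also have "\<dots> = (*v) (?\<rho> k) ` vec.span {F v}"
      by (simp add: span_line image_image diag_mult_vec vec_eq_iff image_iff set_eq_iff mult_ac)
    finally show ?thesis by (simp add: v imF)
  qed
  ultimately have "equivariantly_birational (integer_mod_group n) X (cyclic_action X s)
      projective_space (\<lambda>g p. (*v) (?\<rho> g) ` p)"
    unfolding equivariantly_birational_def
    using FH' HF' by (intro exI[of _ "X \<inter> locus g"] exI[of _ "locus h"] exI[of _ ?F] exI[of _ ?H]) blast
  moreover have "?\<rho> \<in> hom (integer_mod_group n) general_linear_group"
    by (rule diag_character_hom[OF n c])
  ultimately show ?thesis
    unfolding linearizable_def using cyclic_action_regular[OF n X s] n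
    by (auto simp: carrier_integer_mod_group intro!: bexI[of _ ?\<rho>])
qed

subsection \<open>Density in the cubic threefold\<close>

lemma vector_4 [simp]:
  "(vector [a, b, c, d] :: 'a::zero ^ 4) $ 1 = a" "(vector [a, b, c, d] :: 'a::zero ^ 4) $ 2 = b"
  "(vector [a, b, c, d] :: 'a::zero ^ 4) $ 3 = c" "(vector [a, b, c, d] :: 'a::zero ^ 4) $ 4 = d"
  by (simp_all add: vector_def)

lemma vector_6 [simp]:
  "(vector [a, b, c, d, e, f] :: 'a::zero ^ 6) $ 1 = a" "(vector [a, b, c, d, e, f] :: 'a::zero ^ 6) $ 2 = b"
  "(vector [a, b, c, d, e, f] :: 'a::zero ^ 6) $ 3 = c" "(vector [a, b, c, d, e, f] :: 'a::zero ^ 6) $ 4 = d"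
  "(vector [a, b, c, d, e, f] :: 'a::zero ^ 6) $ 5 = e" "(vector [a, b, c, d, e, f] :: 'a::zero ^ 6) $ 6 = f"
  by (simp_all add: vector_def)

lemma exhaust_6:
  fixes x :: 6
  shows "x = 1 \<or> x = 2 \<or> x = 3 \<or> x = 4 \<or> x = 5 \<or> x = 6"
proof (induct x)
  case (of_int z)
  then have "z = 0 \<or> z = 1 \<or> z = 2 \<or> z = 3 \<or> z = 4 \<or> z = 5" by fastforce
  then show ?case by auto
qed

lemma forall_6: "(\<forall>i::6. P i) \<longleftrightarrow> P 1 \<and> P 2 \<and> P 3 \<and> P 4 \<and> P 5 \<and> P 6"
  by (metis exhaust_6)

abbreviation (input) cubic_cone :: "'k::field \<Rightarrow> 'k ^ 6 \<Rightarrow> bool" where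
  "cubic_cone a x \<equiv> x $ 1 * x $ 2 * x $ 3 - x $ 4 * x $ 5 * x $ 6 = 0 \<and>
     a * (x $ 1 + x $ 2 + x $ 3) + x $ 4 + x $ 5 + x $ 6 = 0"

lemma span_in_cubic_threefold:
  assumes "v \<noteq> 0"
  shows "vec.span {v} \<in> cubic_threefold a \<longleftrightarrow> cubic_cone a v"
proof
  assume "vec.span {v} \<in> cubic_threefold a"
  then show "cubic_cone a v" unfolding cubic_threefold_def using vec.span_base[of v "{v}"] by blast
next
  assume v: "cubic_cone a v"
  have "cubic_cone a (c *s v)" for c
  proof -
    have "(c *s v) $ 1 * (c *s v) $ 2 * (c *s v) $ 3 - (c *s v) $ 4 * (c *s v) $ 5 * (c *s v) $ 6
        = c ^ 3 * (v $ 1 * v $ 2 * v $ 3 - v $ 4 * v $ 5 * v $ 6)"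
      "a * ((c *s v) $ 1 + (c *s v) $ 2 + (c *s v) $ 3) + (c *s v) $ 4 + (c *s v) $ 5 + (c *s v) $ 6
        = c * (a * (v $ 1 + v $ 2 + v $ 3) + v $ 4 + v $ 5 + v $ 6)"
      by (simp_all add: algebra_simps power3_eq_cube)
    then show ?thesis using v by simp
  qed
  then have "\<forall>x\<in>vec.span {v}. cubic_cone a x" unfolding span_line by blast
  then show "vec.span {v} \<in> cubic_threefold a"
    using assms by (auto simp: cubic_threefold_def span_in_projective_space)
qed

text \<open>
  If \<open>{i, i', i''} = {1, 2, 3}\<close> and \<open>{j, j', j''} = {4, 5, 6}\<close>, the cubic equation says that \<open>(x\<^sub>i, x\<^sub>j)\<close> is
  proportional to \<open>(x\<^bsub>j'\<^esub> x\<^bsub>j''\<^esub>, x\<^bsub>i'\<^esub> x\<^bsub>i''\<^esub>)\<close>, and the linear equation determines the factor when the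
  following quadric does not vanish. The other four coordinates are then free. The quadrics are
  minors of the Jacobian matrix and have only the nine nodes as common zeros on the threefold.
\<close>

definition minor :: "'k::field \<Rightarrow> 6 \<Rightarrow> 6 \<Rightarrow> 'k ^ 6 \<Rightarrow> 'k" where
  "minor a i j x = a * (\<Prod>k\<in>{4,5,6} - {j}. x $ k) + (\<Prod>k\<in>{1,2,3} - {i}. x $ k)"

lemma triple_enumeration:
  assumes "i \<in> {p, q, r}" "p \<noteq> q" "p \<noteq> r" "q \<noteq> r"
  obtains i' i'' where "{p, q, r} = {i, i', i''}" "i \<noteq> i'" "i \<noteq> i''" "i' \<noteq> i''"
  using assms by (metis insert_commute insertE singletonD)

text \<open>Naming the complementary indices allows all nine pairs \<open>(i, j)\<close> to be
  treated by one computation.\<close>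

lemma index_enumeration:
  assumes "i \<in> {1,2,3::6}" "j \<in> {4,5,6}"
  obtains i' i'' j' j'' where "{1,2,3} = {i,i',i''}" "{4,5,6} = {j,j',j''}" "distinct [i,i',i'',j,j',j'']"
proof -
  obtain i' i'' where i: "{1,2,3} = {i, i', i''}" "i \<noteq> i'" "i \<noteq> i''" "i' \<noteq> i''"
    using triple_enumeration[OF assms(1)] by auto
  obtain j' j'' where j: "{4,5,6} = {j, j', j''}" "j \<noteq> j'" "j \<noteq> j''" "j' \<noteq> j''"
    using triple_enumeration[OF assms(2)] by auto
  have "{1,2,3} \<inter> {4,5,6::6} = {}" by simp
  then have "{i,i',i''} \<inter> {j,j',j''} = {}" using i(1) j(1) by simp
  then show thesis using that i j by auto
qed

text \<open>Both equations involve only the products and sums over the two index triples, so they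
  are invariant under permutations within each triple.\<close>

lemma cubic_cone_indices:
  assumes "{1,2,3} = {i,i',i''}" "{4,5,6} = {j,j',j''}" "distinct [i,i',i'',j,j',j'']"
  shows "cubic_cone a x \<longleftrightarrow> x $ i * x $ i' * x $ i'' = x $ j * x $ j' * x $ j'' \<and>
    a * (x $ i + x $ i' + x $ i'') + x $ j + x $ j' + x $ j'' = 0"
    and "minor a i j x = a * (x $ j' * x $ j'') + x $ i' * x $ i''"
proof -
  have 1: "(\<Prod>k\<in>{1,2,3}. x $ k) = x $ i * x $ i' * x $ i''" "(\<Sum>k\<in>{1,2,3}. x $ k) = x $ i + x $ i' + x $ i''"
    unfolding assms(1) using assms(3) by (simp_all add: algebra_simps)
  have 2: "(\<Prod>k\<in>{4,5,6}. x $ k) = x $ j * x $ j' * x $ j''" "(\<Sum>k\<in>{4,5,6}. x $ k) = x $ j + x $ j' + x $ j''"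
    unfolding assms(2) using assms(3) by (simp_all add: algebra_simps)
  have "cubic_cone a x \<longleftrightarrow> (\<Prod>k\<in>{1,2,3}. x $ k) = (\<Prod>k\<in>{4,5,6}. x $ k) \<and>
    a * (\<Sum>k\<in>{1,2,3}. x $ k) + (\<Sum>k\<in>{4,5,6}. x $ k) = 0"
    by (simp add: algebra_simps)
  then show "cubic_cone a x \<longleftrightarrow> x $ i * x $ i' * x $ i'' = x $ j * x $ j' * x $ j'' \<and>
    a * (x $ i + x $ i' + x $ i'') + x $ j + x $ j' + x $ j'' = 0"
    unfolding 1 2 by (simp add: add.assoc)
  have "{i,i',i''} - {i} = {i',i''}" "{j,j',j''} - {j} = {j',j''}" using assms(3) by auto
  then show "minor a i j x = a * (x $ j' * x $ j'') + x $ i' * x $ i''"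
    unfolding minor_def assms(1,2) using assms(3) by simp
qed

lemma form_minor:
  assumes "i \<in> {1,2,3}" "j \<in> {4,5,6}"
  shows "form 2 (minor a i j)"
proof -
  obtain i' i'' j' j'' where "{1,2,3} = {i,i',i''}" "{4,5,6} = {j,j',j''}" "distinct [i,i',i'',j,j',j'']"
    using index_enumeration[OF assms] .
  from cubic_cone_indices(2)[OF this]
  have "minor a i j = (\<lambda>x. a * (x $ j' * x $ j'') + x $ i' * x $ i'')" by blast
  moreover have "form (1 + 1) (\<lambda>x. a * (x $ j' * x $ j'') + x $ i' * x $ i'')"
    by (intro form_add form_cmult form_mult form_coord)
  ultimately show ?thesis by (simp add: numeral_2_eq_2)
qed

definition polyfun :: "('k::field \<Rightarrow> 'k) \<Rightarrow> bool" where
  "polyfun f \<longleftrightarrow> (\<exists>P. \<forall>s. f s = poly P s)"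

lemma polyfun_intros:
  "polyfun (\<lambda>_. c)" "polyfun (\<lambda>s. s)"
  "polyfun f \<Longrightarrow> polyfun g \<Longrightarrow> polyfun (\<lambda>s. f s + g s)"
  "polyfun f \<Longrightarrow> polyfun g \<Longrightarrow> polyfun (\<lambda>s. f s * g s)"
  "polyfun f \<Longrightarrow> polyfun (\<lambda>s. - f s)"
proof -
  show "polyfun (\<lambda>_. c)" unfolding polyfun_def by (intro exI[of _ "[:c:]"]) simp
  show "polyfun (\<lambda>s. s)" unfolding polyfun_def by (intro exI[of _ "[:0, 1:]"]) simp
  show "polyfun (\<lambda>s. f s + g s)" if "polyfun f" "polyfun g"
    using that unfolding polyfun_def by (metis poly_add)
  show "polyfun (\<lambda>s. f s * g s)" if "polyfun f" "polyfun g"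
    using that unfolding polyfun_def by (metis poly_mult)
  show "polyfun (\<lambda>s. - f s)" if "polyfun f"
    using that unfolding polyfun_def by (metis poly_minus)
qed

text \<open>The straight segment from \<open>v\<close> to \<open>w\<close> in the ambient space is
  pushed into the threefold by a polynomial map \<open>P\<close> that fixes the points spanned by
  \<open>v\<close> and \<open>w\<close>. The image is a curve joining these two points.\<close>

lemma minor_curve:
  fixes a :: "'k::field_char_0"
  assumes ij: "i \<in> {1,2,3}" "j \<in> {4,5,6}"
    and v: "cubic_cone a v" "minor a i j v \<noteq> 0"
    and w: "cubic_cone a w" "minor a i j w \<noteq> 0"
    and g: "form e g" "g w \<noteq> 0"
  shows "vec.span {v} \<in> zariski closure_of (cubic_threefold a \<inter> locus g)"
proof -
  obtain i' i'' j' j'' where split: "{1,2,3} = {i,i',i''}" "{4,5,6} = {j,j',j''}" "distinct [i,i',i'',j,j',j'']"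
    using index_enumeration[OF ij] .
  note cone = cubic_cone_indices(1)[OF split] and minor = cubic_cone_indices(2)[OF split]
  \<comment> \<open>This is the value of \<open>a * u $ i + u $ j\<close> forced by the linear
    equation.\<close>
  define r where "r = (\<lambda>u :: 'k ^ 6. - (a * (u $ i' + u $ i'') + (u $ j' + u $ j'')))"
  \<comment> \<open>If \<open>(u $ i, u $ j)\<close> is a factor times
    \<open>(u $ j' * u $ j'', u $ i' * u $ i'')\<close>, the linear equation makes that factor
    \<open>r u / minor a i j u\<close>. \<open>P\<close> solves for these two coordinates from the
    other four and multiplies everything by \<open>minor a i j u\<close>.\<close>
  define P where "P = (\<lambda>u :: 'k ^ 6. \<chi> k. if k = i then u $ j' * u $ j'' * r u
      else if k = j then u $ i' * u $ i'' * r u else minor a i j u * u $ k)"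
  have P_nth: "P u $ i = u $ j' * u $ j'' * r u" "P u $ j = u $ i' * u $ i'' * r u"
    "P u $ i' = minor a i j u * u $ i'" "P u $ i'' = minor a i j u * u $ i''"
    "P u $ j' = minor a i j u * u $ j'" "P u $ j'' = minor a i j u * u $ j''" for u
    using split(3) by (auto simp: P_def)
  have P_cone: "cubic_cone a (P u)" for u
    unfolding cone P_nth unfolding minor r_def by (simp add: algebra_simps)
  have P_id: "P u = minor a i j u *s u" if "cubic_cone a u" for u
  proof -
    have u: "u $ i * u $ i' * u $ i'' = u $ j * u $ j' * u $ j''"
      "a * (u $ i + u $ i' + u $ i'') + u $ j + u $ j' + u $ j'' = 0"
      using that unfolding cone by auto
    have r: "r u = a * u $ i + u $ j" using u(2) unfolding r_def by algebra
    have "u $ j' * u $ j'' * r u = minor a i j u * u $ i" "u $ i' * u $ i'' * r u = minor a i j u * u $ j"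
      unfolding minor r using u(1) by algebra+
    then show ?thesis by (simp add: P_def vec_eq_iff)
  qed
  define \<gamma> where "\<gamma> = (\<lambda>s. P (v + s *s (w - v)))"
  have pf: "polyfun (\<lambda>s. (v + s *s (w - v)) $ k)" for k
    unfolding polyfun_def by (intro exI[of _ "[:v $ k, w $ k - v $ k:]"]) (simp add: right_diff_distrib)
  have pfr: "polyfun (\<lambda>s. r (v + s *s (w - v)))" unfolding r_def by (intro polyfun_intros pf)
  have pfm: "polyfun (\<lambda>s. minor a i j (v + s *s (w - v)))" unfolding minor by (intro polyfun_intros pf)
  have "polyfun (\<lambda>s. \<gamma> s $ k)" for k
  proof -
    consider "k = i" | "k = j" | "k \<noteq> i" "k \<noteq> j" by blast
    then show ?thesis
    proof cases
      case 1
      then have eq: "(\<lambda>s. \<gamma> s $ k) = (\<lambda>s. (v + s *s (w - v)) $ j' * (v + s *s (w - v)) $ j'' * r (v + s *s (w - v)))"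
        by (simp only: \<gamma>_def P_nth)
      show ?thesis unfolding eq by (intro polyfun_intros(4) pf pfr)
    next
      case 2
      then have eq: "(\<lambda>s. \<gamma> s $ k) = (\<lambda>s. (v + s *s (w - v)) $ i' * (v + s *s (w - v)) $ i'' * r (v + s *s (w - v)))"
        by (simp only: \<gamma>_def P_nth)
      show ?thesis unfolding eq by (intro polyfun_intros(4) pf pfr)
    next
      case 3
      then have eq: "(\<lambda>s. \<gamma> s $ k) = (\<lambda>s. minor a i j (v + s *s (w - v)) * (v + s *s (w - v)) $ k)"
        by (simp add: \<gamma>_def P_def)
      show ?thesis unfolding eq by (intro polyfun_intros(4) pf pfm)
    qed
  qed
  then have poly: "\<exists>Q. \<forall>s. \<gamma> s $ k = poly Q s" for k by (simp add: polyfun_def)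
  have \<gamma>0: "\<gamma> 0 = minor a i j v *s v" and \<gamma>1: "\<gamma> 1 = minor a i j w *s w"
    using P_id v w by (simp_all add: \<gamma>_def)
  have "v \<noteq> 0" using v(2) by (auto simp: minor)
  have "vec.span {\<gamma> 0} \<in> zariski closure_of (cubic_threefold a \<inter> locus g)"
  proof (rule closure_along_curve[where t = 1, OF poly _ g(1)])
    show "vec.span {\<gamma> s} \<in> cubic_threefold a" if "\<gamma> s \<noteq> 0" for s
      using P_cone span_in_cubic_threefold[OF that] by (simp add: \<gamma>_def)
    show "g (\<gamma> 1) \<noteq> 0" using g w(2) by (simp add: \<gamma>1 form_scale)
    show "\<gamma> 0 \<noteq> 0" using v(2) \<open>v \<noteq> 0\<close> by (simp add: \<gamma>0)
  qed
  then show ?thesis using v(2) by (simp add: \<gamma>0 span_line_scale)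
qed

text \<open>A node is not reached by the charts, since all minors vanish there. A line in the
  threefold through the node leaves it into a chart.\<close>

lemma node_curve:
  fixes a :: "'k::field_char_0"
  assumes split: "{1,2,3} = {i,i',i''}" "{4,5,6} = {j,j',j''}" "distinct [i,i',i'',j,j',j'']"
    and a: "a \<noteq> 0" "a \<noteq> -1"
    and v: "v $ i \<noteq> 0" "v $ j = - a * v $ i" "v $ i' = 0" "v $ i'' = 0" "v $ j' = 0" "v $ j'' = 0"
  shows "vec.span {v} \<in> zariski closure_of (cubic_threefold a \<inter> locus (minor a i' j'))"
proof -
  have split': "{1,2,3} = {i',i,i''}" "{4,5,6} = {j',j,j''}" "distinct [i',i,i'',j',j,j'']"
    using split by auto
  note cone = cubic_cone_indices(1)[OF split] and minor = cubic_cone_indices(2)[OF split']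
  \<comment> \<open>The direction must satisfy
    \<open>b $ i' * b $ i'' = - a * (b $ j' * b $ j'')\<close> and the linear equation, with zero
    entries at \<open>i\<close> and \<open>j\<close>. This solution makes
    \<open>minor a i' j'\<close> equal to \<open>- a * (a + 1) * (v $ i)^2\<close> at parameter
    1.\<close>
  define b where "b = (\<chi> k. if k = i' \<or> k = j' then (a - 1) * v $ i
    else if k = i'' then - a * v $ i else if k = j'' then v $ i else 0)"
  define \<gamma> where "\<gamma> = (\<lambda>s. v + s *s b)"
  have b: "b $ i = 0" "b $ j = 0" "b $ i' = (a - 1) * v $ i" "b $ j' = (a - 1) * v $ i"
    "b $ i'' = - a * v $ i" "b $ j'' = v $ i"
    using split(3) by (auto simp: b_def)
  have "v \<noteq> 0" using v(1) by auto
  have poly: "\<exists>Q. \<forall>s. \<gamma> s $ k = poly Q s" for k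
    by (intro exI[of _ "[:v $ k, b $ k:]"]) (simp add: \<gamma>_def)
  have "vec.span {\<gamma> 0} \<in> zariski closure_of (cubic_threefold a \<inter> locus (minor a i' j'))"
  proof (rule closure_along_curve[where t = 1, OF poly])
    have "cubic_cone a (\<gamma> s)" for s
      unfolding cone by (simp add: \<gamma>_def b v algebra_simps)
    then show "vec.span {\<gamma> s} \<in> cubic_threefold a" if "\<gamma> s \<noteq> 0" for s
      using span_in_cubic_threefold[OF that] by simp
    show "form 2 (minor a i' j')" using split by (intro form_minor) auto
    have "minor a i' j' (\<gamma> 1) = - (a * (a + 1) * (v $ i)\<^sup>2)"
      unfolding minor by (simp add: \<gamma>_def b v algebra_simps power2_eq_square)
    moreover have "a + 1 \<noteq> 0" using a(2) by (simp add: eq_neg_iff_add_eq_0)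
    ultimately show "minor a i' j' (\<gamma> 1) \<noteq> 0"
      using a(1) v(1) by simp
    show "\<gamma> 0 \<noteq> 0" using \<open>v \<noteq> 0\<close> by (simp add: \<gamma>_def)
  qed
  then show ?thesis by (simp add: \<gamma>_def)
qed

text \<open>Vanishing minors make all pairwise products within a triple equal, say to
  \<open>p\<close> and \<open>q\<close>, with \<open>p = - a * q\<close>. If \<open>q\<close> is
  nonzero, each triple is constant and the linear equation leads to \<open>a ^ 3 = -1\<close>.
  Otherwise each triple has at most one nonzero entry, and the linear equation forces exactly one in
  each.\<close>

lemma minors_zero_node:
  fixes a :: "'k::field_char_0"
  assumes a: "a \<noteq> 0" "a ^ 3 \<noteq> -1" and v: "v \<noteq> 0" "cubic_cone a v"
    and Q: "\<And>i j. i \<in> {1,2,3} \<Longrightarrow> j \<in> {4,5,6} \<Longrightarrow> minor a i j v = 0"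
  obtains i i' i'' j j' j'' where "{1,2,3} = {i,i',i''}" "{4,5,6} = {j,j',j''}" "distinct [i,i',i'',j,j',j'']"
    "v $ i \<noteq> 0" "v $ j = - a * v $ i" "v $ i' = 0" "v $ i'' = 0" "v $ j' = 0" "v $ j'' = 0"
proof -
  have eq: "v $ i' * v $ i'' = - (a * (v $ j' * v $ j''))"
    if "{1,2,3} = {i,i',i''}" "{4,5,6} = {j,j',j''}" "distinct [i,i',i'',j,j',j'']" for i i' i'' j j' j''
    using Q[of i j] that unfolding cubic_cone_indices(2)[OF that] by (auto simp: add_eq_0_iff)
  have splits: "{1,2,3} = {2,1,3::6}" "{1,2,3} = {3,1,2::6}" "{4,5,6} = {5,4,6::6}" "{4,5,6} = {6,4,5::6}" by auto
  have p: "v $ 2 * v $ 3 = - (a * (v $ 5 * v $ 6))"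
    by (rule eq[OF refl refl]) simp
  have p': "v $ 2 * v $ 3 = - (a * (v $ 4 * v $ 6))" "v $ 2 * v $ 3 = - (a * (v $ 4 * v $ 5))"
    by (rule eq[OF refl splits(3)], simp, rule eq[OF refl splits(4)], simp)
  have p'': "v $ 1 * v $ 3 = - (a * (v $ 5 * v $ 6))" "v $ 1 * v $ 2 = - (a * (v $ 5 * v $ 6))"
    by (rule eq[OF splits(1) refl], simp, rule eq[OF splits(2) refl], simp)
  from p p' have "a * (v $ 4 * v $ 6) = a * (v $ 5 * v $ 6)" "a * (v $ 4 * v $ 5) = a * (v $ 5 * v $ 6)"
    by (metis neg_equal_iff_equal)+
  then have e: "v $ 4 * v $ 6 = v $ 5 * v $ 6" "v $ 4 * v $ 5 = v $ 5 * v $ 6" 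
    using a(1) unfolding mult_cancel_left[of a] by blast+
  have zero: "v $ 5 * v $ 6 = 0"
  proof (rule ccontr)
    assume nz: "v $ 5 * v $ 6 \<noteq> 0"
    then have "v $ 4 = v $ 5" "v $ 6 = v $ 5" using e by auto
    moreover have "v $ 1 = v $ 2" "v $ 3 = v $ 2"
      using p p'' a(1) nz by (metis mult_cancel_left mult_cancel_right mult.commute mult_eq_0_iff neg_equal_0_iff_equal)+
    moreover have "a * (v $ 1 + v $ 2 + v $ 3) + v $ 4 + v $ 5 + v $ 6 = 0" using v by blast
    ultimately have "3 * (v $ 5 + a * v $ 2) = 0" by (simp add: algebra_simps)
    then have 5: "v $ 5 = - a * v $ 2" by (simp add: add_eq_0_iff2)
    have "v $ 2 * v $ 2 = - (a * (v $ 5 * v $ 5))" using p \<open>v $ 3 = v $ 2\<close> \<open>v $ 6 = v $ 5\<close> by simp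
    then have "(a ^ 3 + 1) * (v $ 2 * v $ 2) = 0" unfolding 5 by algebra
    moreover have "v $ 2 \<noteq> 0" using 5 nz by auto
    ultimately show False using a(2) by (simp add: add_eq_0_iff2)
  qed
  then have pairs: "v $ 4 = 0 \<or> v $ 5 = 0" "v $ 4 = 0 \<or> v $ 6 = 0" "v $ 5 = 0 \<or> v $ 6 = 0"
    "v $ 1 = 0 \<or> v $ 2 = 0" "v $ 1 = 0 \<or> v $ 3 = 0" "v $ 2 = 0 \<or> v $ 3 = 0"
    using e p p'' by auto
  have lin: "a * (v $ 1 + v $ 2 + v $ 3) + v $ 4 + v $ 5 + v $ 6 = 0" using v by blast
  have "\<exists>i\<in>{1,2,3}. v $ i \<noteq> 0"
  proof (rule ccontr)
    assume "\<not> (\<exists>i\<in>{1,2,3}. v $ i \<noteq> 0)"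
    then have "v $ 1 = 0" "v $ 2 = 0" "v $ 3 = 0" by auto
    moreover from this have "v $ 4 = 0" "v $ 5 = 0" "v $ 6 = 0" using lin pairs by auto
    ultimately show False using v(1) by (simp add: vec_eq_iff forall_6)
  qed
  then obtain i where i: "i \<in> {1,2,3}" "v $ i \<noteq> 0" by blast
  have "v $ 4 \<noteq> 0 \<or> v $ 5 \<noteq> 0 \<or> v $ 6 \<noteq> 0"
  proof (rule ccontr)
    assume "\<not> (v $ 4 \<noteq> 0 \<or> v $ 5 \<noteq> 0 \<or> v $ 6 \<noteq> 0)"
    then have "v $ 1 + v $ 2 + v $ 3 = 0" using lin a(1) by simp
    then show False using pairs i by auto
  qed
  then obtain j where j: "j \<in> {4,5,6}" "v $ j \<noteq> 0" by auto
  obtain i' i'' j' j'' where split: "{1,2,3} = {i,i',i''}" "{4,5,6} = {j,j',j''}" "distinct [i,i',i'',j,j',j'']"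
    using index_enumeration[OF i(1) j(1)] .
  have "k = i \<or> v $ k = 0" if "k \<in> {1,2,3}" for k using that i pairs by auto
  then have z: "v $ i' = 0" "v $ i'' = 0" unfolding split(1) using split(3) by auto
  have "k = j \<or> v $ k = 0" if "k \<in> {4,5,6}" for k using that j pairs by auto
  then have z': "v $ j' = 0" "v $ j'' = 0" unfolding split(2) using split(3) by auto
  have "v $ j = - a * v $ i"
    using v(2) z z' unfolding cubic_cone_indices(1)[OF split] by (simp add: add_eq_0_iff2)
  then show thesis using that split i z z' by blast
qed

text \<open>
  Two of the open sets \<open>minor a i j \<noteq> 0\<close> sharing an index meet, at the point with coordinates \<open>0\<close> at
  \<open>i\<close> and \<open>j\<close> and \<open>1, -1\<close> at each of the other two pairs.
\<close>

lemma minor_link: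
  fixes a :: "'k::field_char_0"
  assumes a: "a \<noteq> 0" "a \<noteq> -1" and ij: "i \<in> {1,2,3}" "j \<in> {4,5,6}"
    and link: "cubic_threefold a \<inter> locus (minor a i j) \<subseteq> zariski closure_of S"
    and kl: "k \<in> {1,2,3}" "l \<in> {4,5,6}" "k = i \<or> l = j"
  shows "cubic_threefold a \<inter> locus (minor a k l) \<subseteq> zariski closure_of S"
proof -
  obtain i' i'' j' j'' where split: "{1,2,3} = {i,i',i''}" "{4,5,6} = {j,j',j''}" "distinct [i,i',i'',j,j',j'']"
    using index_enumeration[OF ij] .
  define w :: "'k ^ 6" where "w = (\<chi> m. if m = i' \<or> m = j' then 1 else if m = i'' \<or> m = j'' then -1 else 0)"
  have w: "w $ i = 0" "w $ j = 0" "w $ i' = 1" "w $ i'' = -1" "w $ j' = 1" "w $ j'' = -1"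
    using split(3) by (auto simp: w_def)
  have cone: "cubic_cone a w" unfolding cubic_cone_indices(1)[OF split] by (simp add: w)
  have "minor a i j w = - (a + 1)"
    unfolding cubic_cone_indices(2)[OF split] by (simp add: w)
  moreover have "a + 1 \<noteq> 0" using a(2) by (simp add: eq_neg_iff_add_eq_0)
  ultimately have nz: "minor a i j w \<noteq> 0" by (simp del: minus_add_distrib)
  have prods: "(\<Prod>m\<in>{i,i',i''} - {i}. w $ m) = -1" "(\<Prod>m\<in>{i,i',i''} - {i'}. w $ m) = 0"
    "(\<Prod>m\<in>{i,i',i''} - {i''}. w $ m) = 0" "(\<Prod>m\<in>{j,j',j''} - {j}. w $ m) = -1"
    "(\<Prod>m\<in>{j,j',j''} - {j'}. w $ m) = 0" "(\<Prod>m\<in>{j,j',j''} - {j''}. w $ m) = 0"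
    using split(3) by (auto simp: insert_Diff_if w)
  have nz': "minor a k l w \<noteq> 0"
  proof -
    consider "k = i" "l = j" | "k = i" "l \<in> {j',j''}" | "l = j" "k \<in> {i',i''}"
      using kl unfolding split(1,2) by blast
    then show ?thesis
    proof cases
      case 1
      then show ?thesis using nz by simp
    next
      \<comment> \<open>The product over the triple that loses the new index contains a vanishing
        coordinate of \<open>w\<close>, so only one summand of the minor survives. The third case is
        symmetric.\<close>
      case 2
      then have "(\<Prod>m\<in>{j,j',j''} - {l}. w $ m) = 0" using prods by blast
      then have "minor a k l w = -1" unfolding minor_def split(1,2) by (simp only: 2 prods) simp
      then show ?thesis by simp
    next
      case 3
      then have "(\<Prod>m\<in>{i,i',i''} - {k}. w $ m) = 0" using prods by blast
      then have "minor a k l w = - a" unfolding minor_def split(1,2) by (simp only: 3 prods) simp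
      then show ?thesis using a(1) by simp
    qed
  qed
  show ?thesis
  proof
    fix p assume p: "p \<in> cubic_threefold a \<inter> locus (minor a k l)"
    then obtain v where v: "p = vec.span {v}" "v \<noteq> 0"
      by (auto simp: cubic_threefold_def projective_space_def)
    have "cubic_cone a v" "minor a k l v \<noteq> 0"
      using p v span_in_cubic_threefold[OF v(2)] span_in_locus[OF form_minor[OF kl(1,2)] v(2)] by auto
    \<comment> \<open>The curve from \<open>v\<close> to the common point \<open>w\<close> puts
      \<open>p\<close> in the closure of the chart at \<open>(i, j)\<close>; closures being
      idempotent, this lies in the closure of \<open>S\<close>.\<close>
    then have "p \<in> zariski closure_of (cubic_threefold a \<inter> locus (minor a i j))"
      unfolding v(1) using minor_curve[OF kl(1,2) _ _ cone nz' form_minor[OF ij] nz] by blast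
    also have "\<dots> \<subseteq> zariski closure_of (zariski closure_of S)"
      by (rule closure_of_mono[OF link])
    finally show "p \<in> zariski closure_of S" by simp
  qed
qed

text \<open>The closure absorbs first the chart at \<open>(1, 4)\<close>, which contains
  \<open>w\<close>, then the charts at \<open>(1, j)\<close>, then all charts at
  \<open>(i, j)\<close>, and finally the nodes.\<close>

lemma cubic_threefold_dense:
  fixes a :: "'k::field_char_0"
  assumes a: "a \<noteq> 0" "a ^ 3 \<noteq> -1"
    and w: "cubic_cone a w" "minor a 1 4 w \<noteq> 0" and g: "form e g" "g w \<noteq> 0"
  shows "cubic_threefold a \<subseteq> zariski closure_of (cubic_threefold a \<inter> locus g)" (is "_ \<subseteq> ?S")
proof -
  have a1: "a \<noteq> -1" using a(2) by auto
  have X: "\<exists>v. v \<noteq> 0 \<and> p = vec.span {v} \<and> cubic_cone a v" if "p \<in> cubic_threefold a" for p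
  proof -
    from that obtain v where "p = vec.span {v}" "v \<noteq> 0"
      by (auto simp: cubic_threefold_def projective_space_def)
    then show ?thesis using that span_in_cubic_threefold[of v a] by blast
  qed
  have S14: "cubic_threefold a \<inter> locus (minor a 1 4) \<subseteq> ?S"
  proof
    fix p assume p: "p \<in> cubic_threefold a \<inter> locus (minor a 1 4)"
    then obtain v where v: "v \<noteq> 0" "p = vec.span {v}" "cubic_cone a v" using X by blast
    then have "minor a 1 4 v \<noteq> 0" using p span_in_locus[OF form_minor, of 1 4 v a] by auto
    then show "p \<in> ?S" unfolding v(2) using v(3) w g by (intro minor_curve[of 1 4]) auto
  qed
  have S1: "cubic_threefold a \<inter> locus (minor a 1 j) \<subseteq> ?S" if "j \<in> {4,5,6}" for j
    by (rule minor_link[OF a(1) a1 _ _ S14]) (use that in auto)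
  have S: "cubic_threefold a \<inter> locus (minor a i j) \<subseteq> ?S" if "i \<in> {1,2,3}" "j \<in> {4,5,6}" for i j
    by (rule minor_link[OF a(1) a1 _ _ S1[OF that(2)]]) (use that in auto)
  show ?thesis
  proof
    fix p assume p: "p \<in> cubic_threefold a"
    obtain v where v: "v \<noteq> 0" "p = vec.span {v}" "cubic_cone a v" using X[OF p] by blast
    show "p \<in> ?S"
    proof (cases "\<exists>i\<in>{1,2,3}. \<exists>j\<in>{4,5,6}. minor a i j v \<noteq> 0")
      case True
      then obtain i j where ij: "i \<in> {1,2,3}" "j \<in> {4,5,6}" "minor a i j v \<noteq> 0" by blast
      then have "p \<in> locus (minor a i j)"
        using span_in_locus[OF form_minor[OF ij(1,2)] v(1)] v(2) by blast
      then show ?thesis using S ij p by blast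
    next
      case False
      then obtain i i' i'' j j' j'' where n: "{1,2,3} = {i,i',i''}" "{4,5,6} = {j,j',j''}" "distinct [i,i',i'',j,j',j'']"
        "v $ i \<noteq> 0" "v $ j = - a * v $ i" "v $ i' = 0" "v $ i'' = 0" "v $ j' = 0" "v $ j'' = 0"
        using minors_zero_node[OF a v(1,3)] by metis
      have "p \<in> zariski closure_of (cubic_threefold a \<inter> locus (minor a i' j'))"
        unfolding v(2) by (rule node_curve[OF n(1-3) a(1) a1 n(4-)])
      also have "\<dots> \<subseteq> zariski closure_of ?S"
        using S[of i' j'] n(1,2) by (intro closure_of_mono) auto
      finally show ?thesis by simp
    qed
  qed
qed

subsection \<open>The birational map\<close>

lemma cube_root_of_unity_exists: "\<exists>w :: 'k::alg_closed_field. w\<^sup>2 + w + 1 = 0"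
proof -
  obtain w :: 'k where "(\<Sum>k\<le>2. 1 * w ^ k) = 0"
    using alg_closed[of 2 "\<lambda>_. 1 :: 'k"] by auto
  then show ?thesis by (auto simp: numeral_2_eq_2 algebra_simps)
qed

text \<open>
  \<open>pencil (-1) 1 i\<close>, \<open>pencil 1 1 i\<close> and \<open>pencil a 1 i\<close> are \<open>d\<^sub>i\<close>, \<open>d\<^sub>i r\<^sub>i\<close> and \<open>z\<^sub>i\<close>. The map
  \<open>to_space\<close> is \<open>[1 : R\<^sub>0 : R\<^sub>1 : u]\<close> with the denominators cleared.
\<close>

definition pencil :: "'k::field \<Rightarrow> 'k \<Rightarrow> 6 \<Rightarrow> 'k ^ 6 \<Rightarrow> 'k" where
  "pencil b c i x = b * x $ i + c * x $ (i + 3)"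

definition resolvent :: "'k::field \<Rightarrow> 'k \<Rightarrow> 'k \<Rightarrow> 'k \<Rightarrow> 'k" where
  "resolvent c p q r = p + c * q + c\<^sup>2 * r"

definition chords :: "'k::field ^ 6 \<Rightarrow> 'k" where
  "chords x = pencil (-1) 1 1 x * pencil (-1) 1 2 x * pencil (-1) 1 3 x"

text \<open>This is \<open>chords x\<close> times the Lagrange resolvent of the
  \<open>r\<^sub>i\<close> with parameter \<open>c\<close>.\<close>

definition slopes :: "'k::field \<Rightarrow> 'k ^ 6 \<Rightarrow> 'k" where
  "slopes c x = resolvent c
     (pencil 1 1 1 x * pencil (-1) 1 2 x * pencil (-1) 1 3 x)
     (pencil (-1) 1 1 x * pencil 1 1 2 x * pencil (-1) 1 3 x)
     (pencil (-1) 1 1 x * pencil (-1) 1 2 x * pencil 1 1 3 x)"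

definition fibre :: "'k::field \<Rightarrow> 'k \<Rightarrow> 'k ^ 6 \<Rightarrow> 'k" where
  "fibre a c x = resolvent c (pencil a 1 1 x) (pencil a 1 2 x) (pencil a 1 3 x)"

definition to_space :: "'k::field \<Rightarrow> 'k \<Rightarrow> 'k ^ 6 \<Rightarrow> 'k ^ 4" where
  "to_space a w x = vector [chords x * fibre a (w\<^sup>2) x, slopes 1 x * fibre a (w\<^sup>2) x,
     slopes w x * fibre a (w\<^sup>2) x, chords x * fibre a w x]"

text \<open>The factors keep the \<open>d\<^sub>i\<close>, \<open>R\<^sub>1\<close> and the
  denominator of \<open>u\<close> invertible, and the \<open>z\<^sub>i\<close> as well, so that the
  image avoids the zeros of \<open>den\<close> and \<open>zeta\<close>.\<close>

definition to_space_dom :: "'k::field \<Rightarrow> 'k \<Rightarrow> 'k ^ 6 \<Rightarrow> 'k" where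
  "to_space_dom a w x = chords x * slopes w x * (pencil a 1 1 x * pencil a 1 2 x * pencil a 1 3 x) * fibre a (w\<^sup>2) x"

text \<open>
  In the inverse map, \<open>c = 1, \<omega>\<^sup>2, \<omega>\<close> stands for the index \<open>i = 1, 2, 3\<close>: the quotient \<open>rho c / delta\<close>
  is \<open>r\<^sub>i = (R\<^sub>0 + c R\<^sub>1 + c\<^sup>2 R\<^sub>2) / 3\<close> with \<open>R\<^sub>2 = (R\<^sub>0\<^sup>2 + 3) / R\<^sub>1\<close>, \<open>zeta c\<close> is proportional to \<open>z\<^sub>i\<close>, and
  \<open>den a c\<close> clears the denominator of \<open>x\<^sub>i = (r\<^sub>i - 1) z\<^sub>i / ((a + 1) r\<^sub>i + 1 - a)\<close>.
\<close>

definition rho :: "'k::field \<Rightarrow> 'k ^ 4 \<Rightarrow> 'k" where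
  "rho c y = y $ 2 * y $ 3 + c * (y $ 3)\<^sup>2 + c\<^sup>2 * ((y $ 2)\<^sup>2 + 3 * (y $ 1)\<^sup>2)"

definition delta :: "'k::field ^ 4 \<Rightarrow> 'k" where
  "delta y = 3 * (y $ 1 * y $ 3)"

definition zeta :: "'k::field \<Rightarrow> 'k ^ 4 \<Rightarrow> 'k" where
  "zeta c y = c * y $ 4 + c\<^sup>2 * y $ 1"

definition den :: "'k::field \<Rightarrow> 'k \<Rightarrow> 'k ^ 4 \<Rightarrow> 'k" where
  "den a c y = (a + 1) * rho c y + (1 - a) * delta y"

text \<open>Over the common denominator of all three indices, the \<open>i\<close>-th pair of
  coordinates keeps \<open>z\<^sub>i\<close> and the other two factors \<open>den\<close>.\<close>

definition cofactor :: "'k::field \<Rightarrow> 'k \<Rightarrow> 'k \<Rightarrow> 'k \<Rightarrow> 'k ^ 4 \<Rightarrow> 'k" where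
  "cofactor a c c' c'' y = zeta c y * (den a c' y * den a c'' y)"

definition from_space :: "'k::field \<Rightarrow> 'k \<Rightarrow> 'k ^ 4 \<Rightarrow> 'k ^ 6" where
  "from_space a w y = vector [
     (rho 1 y - delta y) * cofactor a 1 (w\<^sup>2) w y, (rho (w\<^sup>2) y - delta y) * cofactor a (w\<^sup>2) w 1 y,
     (rho w y - delta y) * cofactor a w 1 (w\<^sup>2) y,
     (rho 1 y + delta y) * cofactor a 1 (w\<^sup>2) w y, (rho (w\<^sup>2) y + delta y) * cofactor a (w\<^sup>2) w 1 y,
     (rho w y + delta y) * cofactor a w 1 (w\<^sup>2) y]"

definition from_space_dom :: "'k::field \<Rightarrow> 'k \<Rightarrow> 'k ^ 4 \<Rightarrow> 'k" where
  "from_space_dom a w y = (y $ 1 * y $ 3) * (den a 1 y * den a (w\<^sup>2) y * den a w y)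
     * (zeta 1 y * zeta (w\<^sup>2) y * zeta w y)"

section \<open>Degrees of the forms in the two maps, and equivariance\<close>

lemma form_eqI: "form d f \<Longrightarrow> d = e \<Longrightarrow> (\<And>x. f x = g x) \<Longrightarrow> form e g"
  by (metis ext)

lemma form_pencil: "form 1 (pencil b c i)"
  unfolding pencil_def by (intro form_add form_cmult form_coord)

lemma form_resolvent:
  "form d f \<Longrightarrow> form d g \<Longrightarrow> form d h \<Longrightarrow> form d (\<lambda>x. resolvent c (f x) (g x) (h x))"
  unfolding resolvent_def by (intro form_add form_cmult)

lemma form_chords: "form 3 chords"
  by (rule form_eqI[OF form_mult[OF form_mult[OF form_pencil form_pencil] form_pencil] _ chords_def[symmetric]]) simp

lemma form_slopes: "form 3 (slopes c)"
proof -
  have "form 3 (\<lambda>x. pencil b 1 1 x * pencil b' 1 2 x * pencil b'' 1 3 x)" for b b' b'' :: 'a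
    by (rule form_eqI[OF form_mult[OF form_mult[OF form_pencil form_pencil] form_pencil]]) auto
  then show ?thesis unfolding slopes_def by (intro form_resolvent)
qed

lemma form_fibre: "form 1 (fibre a c)"
  unfolding fibre_def by (intro form_resolvent form_pencil)

lemma form_map_to_space: "form_map 4 (to_space a w)"
  unfolding form_map_def forall_4
  by (intro conjI; rule form_eqI[OF form_mult[OF _ form_fibre]]; (rule form_chords form_slopes | simp add: to_space_def))

lemma form_to_space_dom: "form 10 (to_space_dom a w)"
  by (rule form_eqI[OF form_mult[OF form_mult[OF form_mult[OF form_chords form_slopes]
      form_mult[OF form_mult[OF form_pencil form_pencil] form_pencil]] form_fibre] _ to_space_dom_def[symmetric]]) simp

lemma form_quadratic: "form 2 (\<lambda>y. y $ i * y $ j)"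
  by (rule form_eqI[OF form_mult[OF form_coord form_coord]]) auto

lemma form_rho: "form 2 (rho c)"
  unfolding rho_def power2_eq_square by (intro form_add form_cmult form_quadratic)

lemma form_delta: "form 2 delta"
  unfolding delta_def by (intro form_cmult form_quadratic)

lemma form_den: "form 2 (den a c)"
  unfolding den_def by (intro form_add form_cmult form_rho form_delta)

lemma form_zeta: "form 1 (zeta c)"
  unfolding zeta_def by (intro form_add form_cmult form_coord)

lemma form_cofactor: "form 5 (cofactor a c c' c'')"
  by (rule form_eqI[OF form_mult[OF form_zeta form_mult[OF form_den form_den]] _ cofactor_def[symmetric]]) simp

lemma form_map_from_space: "form_map 7 (from_space a w)"
  unfolding form_map_def forall_6
  by (intro conjI; rule form_eqI[OF form_mult[OF _ form_cofactor]];
      (rule form_add[OF form_rho form_delta] form_diff[OF form_rho form_delta] | simp add: from_space_def))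

lemma form_from_space_dom: "form 11 (from_space_dom a w)"
  by (rule form_eqI[OF form_mult[OF form_mult[OF form_quadratic form_mult[OF form_mult[OF form_den form_den] form_den]]
      form_mult[OF form_mult[OF form_zeta form_zeta] form_zeta]] _ from_space_dom_def[symmetric]]) simp

text \<open>A cyclic shift multiplies the resolvent with parameter \<open>c\<close> by
  \<open>c\<close>. The four coordinates acquire the factors \<open>w^2, w^2, 1, w\<close>, from
  which \<open>w^2\<close> is taken out.\<close>

lemma to_space_perm3:
  assumes "w\<^sup>2 + w + 1 = 0"
  shows "to_space a w (perm3 x) = w\<^sup>2 *s (\<chi> i. vector [1, 1, w, w\<^sup>2] $ i * to_space a w x $ i)"
proof -
  have "chords (perm3 x) = chords x"
    by (simp add: chords_def pencil_def perm3_def mult_ac)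
  moreover have "slopes 1 (perm3 x) = slopes 1 x"
    by (simp add: slopes_def resolvent_def pencil_def perm3_def mult_ac add_ac)
  moreover have "slopes w (perm3 x) = w * slopes w x"
    using assms unfolding slopes_def resolvent_def pencil_def perm3_def by simp algebra
  moreover have "fibre a w (perm3 x) = w * fibre a w x"
    using assms unfolding fibre_def resolvent_def pencil_def perm3_def by simp algebra
  moreover have "fibre a (w\<^sup>2) (perm3 x) = w\<^sup>2 * fibre a (w\<^sup>2) x"
    using assms unfolding fibre_def resolvent_def pencil_def perm3_def by simp algebra
  moreover have "w\<^sup>2 * w\<^sup>2 = w" using assms by algebra
  ultimately show ?thesis
    by (simp add: vec_eq_iff forall_4 to_space_def mult_ac)
qed

text \<open>Exchanging the two triples negates each \<open>d\<^sub>i\<close>. It preserves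
  \<open>z\<^sub>i\<close> because \<open>a = 1\<close>. Hence \<open>chords\<close> changes sign
  while \<open>slopes\<close>, having two factors \<open>d\<^sub>i\<close> in each term, does
  not.\<close>

lemma to_space_perm6:
  assumes "w\<^sup>2 + w + 1 = 0"
  shows "to_space 1 w (perm6 x) = - w\<^sup>2 *s (\<chi> i. vector [1, -1, -w, w\<^sup>2] $ i * to_space 1 w x $ i)"
proof -
  have "chords (perm6 x) = - chords x"
    unfolding chords_def pencil_def perm6_def by simp algebra
  moreover have "slopes 1 (perm6 x) = slopes 1 x"
    unfolding slopes_def resolvent_def pencil_def perm6_def by simp algebra
  moreover have "slopes w (perm6 x) = w * slopes w x"
    using assms unfolding slopes_def resolvent_def pencil_def perm6_def by simp algebra
  moreover have "fibre 1 w (perm6 x) = w * fibre 1 w x"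
    using assms unfolding fibre_def resolvent_def pencil_def perm6_def by simp algebra
  moreover have "fibre 1 (w\<^sup>2) (perm6 x) = w\<^sup>2 * fibre 1 (w\<^sup>2) x"
    using assms unfolding fibre_def resolvent_def pencil_def perm6_def by simp algebra
  moreover have "w\<^sup>2 * w\<^sup>2 = w" using assms by algebra
  ultimately show ?thesis
    by (simp add: vec_eq_iff forall_4 to_space_def mult_ac)
qed

text \<open>The quotients \<open>r1 / t\<close>, \<open>r2 / t\<close>, \<open>r3 / t\<close> lie on
  the quadric and have the prescribed resolvents, so the forward map recovers the coordinates of
  \<open>y\<close>.\<close>

lemma to_space_from_space:
  fixes y :: "'k::field_char_0 ^ 4"
  assumes w: "w\<^sup>2 + w + 1 = 0" and y: "from_space_dom a w y \<noteq> 0"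
  shows "from_space a w y \<noteq> 0 \<and> cubic_cone a (from_space a w y) \<and> to_space_dom a w (from_space a w y) \<noteq> 0 \<and>
    (\<exists>m. m \<noteq> 0 \<and> to_space a w (from_space a w y) = m *s y)"
proof -
  define x where "x = from_space a w y"
  define m1 m2 m3 where "m1 = cofactor a 1 (w\<^sup>2) w y" and "m2 = cofactor a (w\<^sup>2) w 1 y" and "m3 = cofactor a w 1 (w\<^sup>2) y"
  define e where "e = den a 1 y * den a (w\<^sup>2) y * den a w y"
  define r1 r2 r3 t where "r1 = rho 1 y" and "r2 = rho (w\<^sup>2) y" and "r3 = rho w y" and "t = delta y"
  have x: "x $ 1 = (r1 - t) * m1" "x $ 2 = (r2 - t) * m2" "x $ 3 = (r3 - t) * m3"
    "x $ 4 = (r1 + t) * m1" "x $ 5 = (r2 + t) * m2" "x $ 6 = (r3 + t) * m3"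
    by (simp_all add: x_def from_space_def m1_def m2_def m3_def r1_def r2_def r3_def t_def)
  have nz: "y $ 1 \<noteq> 0" "y $ 3 \<noteq> 0" "t \<noteq> 0" "m1 \<noteq> 0" "m2 \<noteq> 0" "m3 \<noteq> 0" "e \<noteq> 0"
    "zeta 1 y \<noteq> 0" "zeta (w\<^sup>2) y \<noteq> 0" "zeta w y \<noteq> 0"
    using y by (auto simp: from_space_dom_def e_def m1_def m2_def m3_def cofactor_def t_def delta_def)
  have r: "r1 * r2 + r2 * r3 + r3 * r1 = - (t\<^sup>2)"
    "r1 + r2 + r3 = 3 * (y $ 2 * y $ 3)" "r1 + w * r2 + w\<^sup>2 * r3 = 3 * (y $ 3)\<^sup>2"
    using w unfolding r1_def r2_def r3_def t_def rho_def delta_def power_one mult_1_left by algebra+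
  have d: "pencil (-1) 1 1 x = 2 * t * m1" "pencil (-1) 1 2 x = 2 * t * m2" "pencil (-1) 1 3 x = 2 * t * m3"
    "pencil 1 1 1 x = 2 * r1 * m1" "pencil 1 1 2 x = 2 * r2 * m2" "pencil 1 1 3 x = 2 * r3 * m3"
    by (simp_all add: pencil_def x algebra_simps)
  \<comment> \<open>The two entries combine by
    \<open>a * (r - t) + (r + t) = (a + 1) * r + (1 - a) * t\<close>, which is the factor
    \<open>den\<close> missing from the cofactor.\<close>
  have z: "pencil a 1 1 x = e * zeta 1 y" "pencil a 1 2 x = e * zeta (w\<^sup>2) y" "pencil a 1 3 x = e * zeta w y"
    unfolding pencil_def by (simp_all add: x m1_def m2_def m3_def cofactor_def e_def)
      (simp_all add: den_def r1_def r2_def r3_def t_def algebra_simps)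
  have zsum: "zeta 1 y + zeta (w\<^sup>2) y + zeta w y = 0" "resolvent w (zeta 1 y) (zeta (w\<^sup>2) y) (zeta w y) = 3 * y $ 4"
    "resolvent (w\<^sup>2) (zeta 1 y) (zeta (w\<^sup>2) y) (zeta w y) = 3 * y $ 1"
    using w unfolding zeta_def resolvent_def power_one mult_1_left by algebra+
  have chords: "chords x = 8 * t ^ 3 * (m1 * m2 * m3)"
    by (simp add: chords_def d power3_eq_cube)
  have slopes: "slopes c x = 8 * t\<^sup>2 * (m1 * m2 * m3) * (r1 + c * r2 + c\<^sup>2 * r3)" for c
    by (simp add: slopes_def d resolvent_def power2_eq_square algebra_simps)
  have "fibre a c x = e * resolvent c (zeta 1 y) (zeta (w\<^sup>2) y) (zeta w y)" for c
    by (simp add: fibre_def z resolvent_def algebra_simps)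
  then have fibre: "fibre a w x = e * (3 * y $ 4)" "fibre a (w\<^sup>2) x = e * (3 * y $ 1)"
    by (simp_all only: zsum)
  have "cubic_cone a x"
  proof
    \<comment> \<open>The difference equals \<open>-2 * t\<close> times
      \<open>r1 * r2 + r2 * r3 + r3 * r1 + t^2\<close>, so the cubic equation is the
      quadric.\<close>
    have "(r1 - t) * (r2 - t) * (r3 - t) - (r1 + t) * (r2 + t) * (r3 + t) = 0" using r(1) by algebra
    then have "((r1 - t) * (r2 - t) * (r3 - t) - (r1 + t) * (r2 + t) * (r3 + t)) * (m1 * m2 * m3) = 0" by simp
    then show "x $ 1 * x $ 2 * x $ 3 - x $ 4 * x $ 5 * x $ 6 = 0"
      unfolding x by (simp add: algebra_simps)
    have "a * (x $ 1 + x $ 2 + x $ 3) + x $ 4 + x $ 5 + x $ 6 = pencil a 1 1 x + pencil a 1 2 x + pencil a 1 3 x"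
      by (simp add: pencil_def algebra_simps)
    also have "\<dots> = e * (zeta 1 y + zeta (w\<^sup>2) y + zeta w y)" by (simp add: z algebra_simps)
    finally show "a * (x $ 1 + x $ 2 + x $ 3) + x $ 4 + x $ 5 + x $ 6 = 0" using zsum(1) by simp
  qed
  moreover have dom: "to_space_dom a w x \<noteq> 0"
    unfolding to_space_dom_def using nz by (simp add: chords slopes r z fibre)
  moreover have "x \<noteq> 0" using dom by (auto simp: to_space_dom_def chords_def pencil_def)
  moreover have "to_space a w x = (72 * t\<^sup>2 * (m1 * m2 * m3) * e * y $ 1 * y $ 3) *s y"
  proof -
    have t: "t = 3 * (y $ 1 * y $ 3)" by (simp add: t_def delta_def)
    have s1: "slopes 1 x = 8 * t\<^sup>2 * (m1 * m2 * m3) * (3 * (y $ 2 * y $ 3))"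
      using slopes[of 1] r(2) by simp
    have sw: "slopes w x = 8 * t\<^sup>2 * (m1 * m2 * m3) * (3 * (y $ 3)\<^sup>2)"
      using slopes[of w] r(3) by simp
    \<comment> \<open>One factor \<open>t\<close> is expanded so that every coordinate shows the
      same scalar, with \<open>72 = 8 * 3 * 3\<close>.\<close>
    have ch: "chords x = 8 * t\<^sup>2 * (m1 * m2 * m3) * (3 * (y $ 1 * y $ 3))"
      unfolding chords using t by (simp add: power3_eq_cube power2_eq_square)
    show ?thesis
      by (simp add: to_space_def vec_eq_iff forall_4 s1 sw ch fibre power2_eq_square[of "y $ 3"])
  qed
  ultimately show ?thesis
    using nz unfolding x_def[symmetric] by (intro conjI exI[of _ "72 * t\<^sup>2 * (m1 * m2 * m3) * e * y $ 1 * y $ 3"]) auto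
qed

text \<open>The image is rescaled to the vector \<open>y\<close> with first coordinate 1, whose
  entries are the affine coordinates of the birational map; homogeneity restores the factor at the
  end.\<close>

lemma from_space_to_space:
  fixes x :: "'k::field_char_0 ^ 6"
  assumes w: "w\<^sup>2 + w + 1 = 0" and cone: "cubic_cone a x" and x: "to_space_dom a w x \<noteq> 0"
  shows "to_space a w x \<noteq> 0 \<and> from_space_dom a w (to_space a w x) \<noteq> 0 \<and>
    (\<exists>m. m \<noteq> 0 \<and> from_space a w (to_space a w x) = m *s x)"
proof -
  define d1 d2 d3 where "d1 = x $ 4 - x $ 1" and "d2 = x $ 5 - x $ 2" and "d3 = x $ 6 - x $ 3"
  define s1 s2 s3 where "s1 = x $ 4 + x $ 1" and "s2 = x $ 5 + x $ 2" and "s3 = x $ 6 + x $ 3"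
  define z1 z2 z3 where "z1 = a * x $ 1 + x $ 4" and "z2 = a * x $ 2 + x $ 5" and "z3 = a * x $ 3 + x $ 6"
  define f f' where "f = fibre a w x" and "f' = fibre a (w\<^sup>2) x"
  define k where "k = chords x * f'"
  define r0 r t where "r0 = s1 / d1 + s2 / d2 + s3 / d3" and "r = s1 / d1 + w * (s2 / d2) + w\<^sup>2 * (s3 / d3)"
    and "t = s1 / d1 + w\<^sup>2 * (s2 / d2) + w * (s3 / d3)"
  define y :: "'k ^ 4" where "y = vector [1, r0, r, f / f']"
  have pencil: "pencil (-1) 1 1 x = d1" "pencil (-1) 1 2 x = d2" "pencil (-1) 1 3 x = d3"
    "pencil 1 1 1 x = s1" "pencil 1 1 2 x = s2" "pencil 1 1 3 x = s3"
    "pencil a 1 1 x = z1" "pencil a 1 2 x = z2" "pencil a 1 3 x = z3"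
    by (simp_all add: pencil_def d1_def d2_def d3_def s1_def s2_def s3_def z1_def z2_def z3_def)
  have chords: "chords x = d1 * d2 * d3" by (simp add: chords_def pencil)
  have nz: "d1 \<noteq> 0" "d2 \<noteq> 0" "d3 \<noteq> 0" "z1 \<noteq> 0" "z2 \<noteq> 0" "z3 \<noteq> 0" "f' \<noteq> 0" "slopes w x \<noteq> 0"
    using x by (auto simp: to_space_dom_def chords pencil f'_def)
  have slopes: "slopes 1 x = chords x * r0" "slopes w x = chords x * r"
    using nz by (simp_all add: slopes_def pencil resolvent_def chords r0_def r_def field_simps)
  have "r \<noteq> 0" using nz(8) slopes by auto
  have "k \<noteq> 0" using nz by (simp add: k_def chords)
  have k: "to_space a w x = k *s y"
    using nz by (simp add: to_space_def vec_eq_iff forall_4 y_def k_def slopes f_def[symmetric] f'_def[symmetric])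
  have "z1 + z2 + z3 = 0" using cone by (simp add: z1_def z2_def z3_def algebra_simps)
  \<comment> \<open>This is Fourier inversion on three points; the resolvent with parameter 1
    vanishes by the linear equation.\<close>
  then have ff: "f + f' = 3 * z1" "w\<^sup>2 * f + w * f' = 3 * z2" "w * f + w\<^sup>2 * f' = 3 * z3"
    using w unfolding f_def f'_def fibre_def pencil resolvent_def by algebra+
  have "w\<^sup>2 * w\<^sup>2 = w" using w by algebra
  then have zeta: "zeta 1 y = 3 * z1 / f'" "zeta (w\<^sup>2) y = 3 * z2 / f'" "zeta w y = 3 * z3 / f'"
    unfolding ff[symmetric] using nz by (simp_all add: zeta_def y_def power2_eq_square[of "w\<^sup>2"] field_simps)
  have "s1 * s2 * d3 + d1 * s2 * s3 + s1 * d2 * s3 + d1 * d2 * d3 = 0"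
    using cone unfolding d1_def d2_def d3_def s1_def s2_def s3_def by algebra
  then have "(s1 / d1) * (s2 / d2) + (s2 / d2) * (s3 / d3) + (s3 / d3) * (s1 / d1) + 1 = 0"
    using nz by (simp add: field_simps)
  \<comment> \<open>On the quadric \<open>r0^2 + 3 = r * t\<close>, so \<open>rho c y\<close> is
    \<open>r * (r0 + c * r + c^2 * t)\<close>, and the second factor inverts the resolvents.\<close>
  then have rho: "rho 1 y = 3 * r * (s1 / d1)" "rho (w\<^sup>2) y = 3 * r * (s2 / d2)" "rho w y = 3 * r * (s3 / d3)"
    using w unfolding rho_def y_def vector_4 r_def r0_def power_one mult_1_left by algebra+
  have delta: "delta y = 3 * r" by (simp add: delta_def y_def)
  have den: "den a 1 y = 6 * r * (z1 / d1)" "den a (w\<^sup>2) y = 6 * r * (z2 / d2)" "den a w y = 6 * r * (z3 / d3)"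
    using nz by (simp_all add: den_def rho delta field_simps)
      (simp_all add: z1_def z2_def z3_def d1_def d2_def d3_def s1_def s2_def s3_def algebra_simps)
  have num: "rho 1 y - delta y = 6 * r * (x $ 1 / d1)" "rho (w\<^sup>2) y - delta y = 6 * r * (x $ 2 / d2)"
    "rho w y - delta y = 6 * r * (x $ 3 / d3)" "rho 1 y + delta y = 6 * r * (x $ 4 / d1)"
    "rho (w\<^sup>2) y + delta y = 6 * r * (x $ 5 / d2)" "rho w y + delta y = 6 * r * (x $ 6 / d3)"
    using nz by (simp_all add: rho delta field_simps)
      (simp_all add: d1_def d2_def d3_def s1_def s2_def s3_def algebra_simps)
  \<comment> \<open>Each coordinate is a product of one entry of \<open>num\<close>, one of
    \<open>zeta\<close> and two of \<open>den\<close>, whence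
    \<open>648 = 6 * 3 * 6 * 6\<close>.\<close>
  define m where "m = 648 * r ^ 3 * (z1 * z2 * z3) / (d1 * d2 * d3 * f')"
  have m: "from_space a w y = m *s x"
    unfolding from_space_def cofactor_def num den zeta vec_eq_iff forall_6
    by (simp add: m_def power3_eq_cube mult_ac)
  have "m \<noteq> 0" using nz \<open>r \<noteq> 0\<close> by (simp add: m_def)
  have "from_space a w (to_space a w x) = (k ^ 7 * m) *s x"
    unfolding k form_map_scale[OF form_map_from_space] m by (simp add: vector_smult_assoc)
  moreover have "from_space_dom a w (to_space a w x) \<noteq> 0"
  proof -
    have "from_space_dom a w y \<noteq> 0"
      unfolding from_space_dom_def den zeta using nz \<open>r \<noteq> 0\<close> by (simp add: y_def)
    then show ?thesis unfolding k form_scale[OF form_from_space_dom] using \<open>k \<noteq> 0\<close> by simp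
  qed
  moreover have "y $ 1 = 1" by (simp add: y_def)
  then have "to_space a w x \<noteq> 0" unfolding k using \<open>k \<noteq> 0\<close> by auto
  ultimately show ?thesis using \<open>k \<noteq> 0\<close> \<open>m \<noteq> 0\<close> by (intro conjI exI[of _ "k ^ 7 * m"]) auto
qed

text \<open>This covers both actions at once: only the generator \<open>s\<close>, its order and its
  semi-invariance under \<open>to_space\<close> remain to be supplied.\<close>

lemma linearizable_cubic_threefold:
  fixes a :: "'k::field_char_0"
  assumes a: "a \<noteq> 0" "a ^ 3 \<noteq> -1" and w: "w\<^sup>2 + w + 1 = 0"
    and n: "0 < n" and s: "form_map 1 s" "\<And>v. (s ^^ n) v = v"
      "\<And>v. cubic_cone a v \<Longrightarrow> cubic_cone a (s v)"
    and c: "\<And>i. c $ i ^ n = 1" and equi: "l \<noteq> 0" "\<And>x. to_space a w (s x) = l *s (\<chi> i. c $ i * to_space a w x $ i)"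
  shows "linearizable (integer_mod_group n) (cubic_threefold a) (cyclic_action (cubic_threefold a) s)"
proof -
  have s0: "s v = 0 \<longleftrightarrow> v = 0" for v
  proof
    assume "s v = 0"
    have "(s ^^ m) 0 = 0" for m
      using form_map_scale[OF s(1), of 0 0] by (induction m) auto
    then have "(s ^^ Suc (n - 1)) v = 0" using \<open>s v = 0\<close> by (simp only: funpow_Suc_right comp_def)
    then show "v = 0" using s(2)[of v] n by simp
  qed (use form_map_scale[OF s(1), of 0 0] in simp)
  have s_closed: "s ` p \<in> cubic_threefold a" if p: "p \<in> cubic_threefold a" for p
  proof -
    obtain v where v: "p = vec.span {v}" "v \<noteq> 0"
      using p by (auto simp: cubic_threefold_def projective_space_def)
    then show ?thesis
      using p s(3)[of v] s0[of v] span_in_cubic_threefold[of v a] span_in_cubic_threefold[of "s v" a]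
      by (simp add: image_line[OF s(1)])
  qed
  \<comment> \<open>An explicit point of the threefold at which \<open>minor a 1 4\<close> and every
    factor of \<open>to_space_dom\<close> are nonzero. It starts the density argument, and its image
    shows that the target domain is nonempty.\<close>
  define p :: "'k ^ 6" where "p = vector [1, 0, 0, 0, a, -2 * a]"
  have w_nz: "w \<noteq> 0" using w by auto
  have pencils: "pencil b 1 1 p = b" "pencil b 1 2 p = a" "pencil b 1 3 p = - 2 * a" for b
    by (simp_all add: pencil_def p_def)
  have cone: "cubic_cone a p" by (simp add: p_def)
  have "({4,5,6} - {4} :: 6 set) = {5,6}" "({1,2,3} - {1} :: 6 set) = {2,3}" by auto
  then have minor: "minor a 1 4 p \<noteq> 0"
    using a(1) by (simp add: minor_def p_def)
  have "slopes w p = - 4 * a\<^sup>2"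
    using w unfolding slopes_def resolvent_def pencils by algebra
  moreover have "fibre a (w\<^sup>2) p = - 3 * a * w"
    using w unfolding fibre_def resolvent_def pencils by algebra
  ultimately have dom: "to_space_dom a w p \<noteq> 0"
    using a(1) w_nz by (simp add: to_space_dom_def chords_def pencils)
  have dom': "from_space_dom a w (to_space a w p) \<noteq> 0"
    using from_space_to_space[OF w cone dom] by blast
  show ?thesis
  proof (rule linearizableI[OF n _ s(1,2) s_closed c form_map_to_space form_map_from_space
        form_to_space_dom form_from_space_dom dom' cubic_threefold_dense[OF a cone minor form_to_space_dom dom] _ _ equi])
    show "cubic_threefold a \<subseteq> projective_space" by (auto simp: cubic_threefold_def)
  next
    fix v assume "v \<noteq> 0" "vec.span {v} \<in> cubic_threefold a" "to_space_dom a w v \<noteq> 0"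
    then show "to_space a w v \<noteq> 0 \<and> from_space_dom a w (to_space a w v) \<noteq> 0 \<and>
        (\<exists>m. m \<noteq> 0 \<and> from_space a w (to_space a w v) = m *s v)"
      using from_space_to_space[OF w] span_in_cubic_threefold by blast
  next
    fix y :: "'k ^ 4" assume "from_space_dom a w y \<noteq> 0"
    then show "from_space a w y \<noteq> 0 \<and> vec.span {from_space a w y} \<in> cubic_threefold a \<and>
        to_space_dom a w (from_space a w y) \<noteq> 0 \<and> (\<exists>m. m \<noteq> 0 \<and> to_space a w (from_space a w y) = m *s y)"
      using to_space_from_space[OF w] span_in_cubic_threefold by blast
  qed
qed

theorem corollary9p2:
  shows "(\<forall>a :: 'k :: {alg_closed_field, field_char_0}. a ^ 3 \<noteq> 0 \<and> a ^ 3 \<noteq> - 1 \<longrightarrow>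
            linearizable (integer_mod_group 3) (cubic_threefold a)
              (cyclic_action (cubic_threefold a) perm3)) \<and>
         linearizable (integer_mod_group 6) (cubic_threefold (1 :: 'k))
           (cyclic_action (cubic_threefold 1) perm6)"
proof -
  obtain w :: 'k where w: "w\<^sup>2 + w + 1 = 0" using cube_root_of_unity_exists by blast
  then have w3: "w ^ 3 = 1" by algebra
  \<comment> \<open>These powers occur for the diagonal entries \<open>w^2\<close> and
    \<open>-w\<close>, raised to the orders 3 and 6.\<close>
  then have w6: "w ^ 6 = 1" and w12: "w ^ 12 = 1" by algebra+
  have w_nz: "w \<noteq> 0" using w by auto
  have form3: "form_map 1 (perm3 :: 'k ^ 6 \<Rightarrow> _)" and form6: "form_map 1 (perm6 :: 'k ^ 6 \<Rightarrow> _)"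
    unfolding form_map_def forall_6 perm3_def perm6_def vector_6 by (intro conjI form_coord)+
  have "linearizable (integer_mod_group 3) (cubic_threefold a) (cyclic_action (cubic_threefold a) perm3)"
    if a: "a ^ 3 \<noteq> 0" "a ^ 3 \<noteq> - 1" for a :: 'k
  proof (rule linearizable_cubic_threefold[OF _ a(2) w _ form3 _ _ _ _ to_space_perm3[OF w]])
    show "(vector [1, 1, w, w\<^sup>2] :: 'k ^ 4) $ i ^ 3 = 1" for i
      using exhaust_4[of i] w3 w6 by (auto simp flip: power_mult)
  qed (use a w_nz in \<open>auto simp: perm3_def numeral_3_eq_3 vec_eq_iff forall_6 algebra_simps\<close>)
  moreover have "linearizable (integer_mod_group 6) (cubic_threefold (1 :: 'k)) (cyclic_action (cubic_threefold 1) perm6)"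
  proof (rule linearizable_cubic_threefold[OF _ _ w _ form6 _ _ _ _ to_space_perm6[OF w]])
    show "(vector [1, -1, -w, w\<^sup>2] :: 'k ^ 4) $ i ^ 6 = 1" for i
      using exhaust_4[of i] w6 w12 by (auto simp flip: power_mult)
  qed (use w_nz in \<open>auto simp: perm6_def eval_nat_numeral vec_eq_iff forall_6 algebra_simps\<close>)
  ultimately show ?thesis by blast
qed

end
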